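(* Let $T>0$, $q\neq 0$, $\sigma>0$, $b\in\mathbb{R}$. Let $U^0$ be the Ornstein-Uhlenbeck process with parameters $q,\sigma$ starting in $0$, and let $U^{\rm av}$, $U^{\rm ir}$, $U^{\rm st}$ be the anticipative version, the integral representation and the space-time transform of the Ornstein-Uhlenbeck bridge from $0$ to $b$ over the time-interval $[0,T]$, all constructed from the same standard Wiener process $W$. Then $$\mathbb{E}\left(\int_0^T(U^0_t-U_t^{\rm av})^2\,\mathrm{d}t\right)=\frac{b^2}{4q}\cdot\frac{\sinh(2qT)-2qT}{\sinh^2(qT)}+\frac{\sigma^2 e^{qT}}{4q^2}\cdot\frac{\sinh(2qT)-2qT}{\sinh(qT)},$$ $$\begin{aligned}\mathbb{E}\left(\int_0^T(U^0_t-U_t^{\rm ir})^2\,\mathrm{d}t\right)=\;&\frac{b^2}{4q}\cdot\frac{\sinh(2qT)-2qT}{\sinh^2(qT)}+\frac{\sigma^2 e^{qT}}{4q^2}\cdot\frac{\sinh(2qT)-2qT}{\sinh(qT)}-\frac{\sigma^2}{q^2}\\&+\frac{T\sigma^2\cosh(qT)}{q\sinh(qT)}-\frac{\sigma^2T^2}{2}+\frac{\sigma^2T}{2q}-\frac{\sigma^2}{4q^2}+\frac{\sigma^2}{4q^2}e^{-2qT}\\&-\frac{\sigma^2}{q^2}\int_0^{qT}(1-e^{-2x})\log\frac{\sinh(qT)}{\sinh(x)}\,\mathrm{d}x,\end{aligned}$$ $$\begin{aligned}\mathbb{E}\left(\int_0^T(U^0_t-U_t^{\rm st})^2\,\mathrm{d}t\right)=\;&\frac{\sigma^2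 e^{qT}}{4q^2}\cdot\frac{\sinh(2qT)-2qT}{\sinh(qT)}+\frac{2\sigma^2}{q^2}\cdot\frac{\cosh(qT)-1}{\sinh(qT)}\\&-\frac{\sigma^2}{q}\left(\frac{\sinh(2qT)}{2q}+T\right)+\frac{\sigma^2\cosh(qT)}{2q^2\sinh(qT)}(\cosh(2qT)-1).\end{aligned}$$
   Context: $(W_t)_{t\ge0}$ is a standard one-dimensional Wiener process. For $q\ne0$, $\sigma>0$, the Ornstein-Uhlenbeck process starting in $0$ is $U^0_t=\sigma\int_0^t e^{q(t-s)}\,\mathrm{d}W_s$, $t\ge0$ (the unique strong solution of $\mathrm{d}U_t=qU_t\,\mathrm{d}t+\sigma\,\mathrm{d}W_t$, $U_0=0$). With $\kappa(t)=\frac{1-e^{-2qt}}{2q}$, the following versions of the Ornstein-Uhlenbeck bridge from $0$ to $b$ over $[0,T]$ are considered, all built from this same $W$: Anticipative version: $U_t^{\rm av}=b\frac{\sinh(qt)}{\sinh(qT)}+\left(U^0_t-\frac{\sinh(qt)}{\sinh(qT)}U^0_T\right)$ for $0\le t\le T$. Integral representation: $U_t^{\rm ir}=b\frac{\sinh(qt)}{\sinh(qT)}+\sigma\int_0^t\frac{\sinh(q(T-t))}{\sinh(q(T-s))}\,\mathrm{d}W_s$ for $0\le t<T$, and $U_T^{\rm ir}=b$. Space-time transform: $U_t^{\rm st}=b\frac{\sinh(qt)}{\sinh(qT)}+\sigma e^{qt}\frac{\kappa(T)-\kappa(t)}{\kappa(T)}W_{\frac{\kappa(t)\kappa(T)}{\kappa(T)-\kappa(t)}}$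 for $0\le t<T$, and $U_T^{\rm st}=b$. For $q<0$, the integral $\int_0^{qT}$ is the oriented integral.
   Formalization: The third formula as stated fails for b≠0, since it omits the contribution of the bridge's mean; the formal version adds the summand b²/(4q)·(sinh(2qT)−2qT)/sinh²(qT) to its right-hand side and coincides with the stated formula when b=0. *)

theory Defs
  imports "HOL-Probability.Probability"
begin

text \<open>
  Processes are functions \<open>real \<Rightarrow> 'a \<Rightarrow> real\<close> (time first); only their values at nonnegative times matter.
  Every path of a Wiener process is required to be continuous (not just almost every path), so that
  pathwise time integrals are measurable without completeness of the probability space.
\<close>

locale wiener_process = prob_space M for M :: "'a measure" +
  fixes W :: "real \<Rightarrow> 'a \<Rightarrow> real"
  assumes measurable_W: "0 \<le> t \<Longrightarrow> random_variable borel (W t)"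
    and W_zero: "AE \<omega> in M. W 0 \<omega> = 0"
    and indep_increments:
      "\<lbrakk>0 \<le> \<tau> 0; \<And>i. i < n \<Longrightarrow> \<tau> i < \<tau> (Suc i)\<rbrakk> \<Longrightarrow>
        indep_vars (\<lambda>_. borel) (\<lambda>i \<omega>. W (\<tau> (Suc i)) \<omega> - W (\<tau> i) \<omega>) {..<n::nat}"
    and normal_increments:
      "\<lbrakk>0 \<le> s; s < t\<rbrakk> \<Longrightarrow>
        distributed M lborel (\<lambda>\<omega>. W t \<omega> - W s \<omega>) (normal_density 0 (sqrt (t - s)))"
    and continuous_paths: "\<omega> \<in> space M \<Longrightarrow> continuous_on {0..} (\<lambda>t. W t \<omega>)"

text \<open>
  A list of triples \<open>(c, u, v)\<close> represents the step function \<open>\<Sum> c \<cdot> 1\<^bsub>(u, v]\<^esub>\<close>, whose integral with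
  respect to \<open>W\<close> is \<open>\<Sum> c \<cdot> (W\<^sub>v - W\<^sub>u)\<close>; the intervals may overlap.
\<close>

definition steps_in :: "real \<Rightarrow> real \<Rightarrow> (real \<times> real \<times> real) list \<Rightarrow> bool" where
  "steps_in a b ps \<longleftrightarrow> (\<forall>(c, u, v) \<in> set ps. a \<le> u \<and> u \<le> v \<and> v \<le> b)"

definition step_fun :: "(real \<times> real \<times> real) list \<Rightarrow> real \<Rightarrow> real" where
  "step_fun ps s = (\<Sum>(c, u, v) \<leftarrow> ps. c * indicator {u<..v} s)"

definition step_wiener_integral ::
    "(real \<Rightarrow> 'a \<Rightarrow> real) \<Rightarrow> (real \<times> real \<times> real) list \<Rightarrow> 'a \<Rightarrow> real" where
  "step_wiener_integral W ps \<omega> = (\<Sum>(c, u, v) \<leftarrow> ps. c * (W v \<omega> - W u \<omega>))"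

text \<open>
  \<open>X\<close> is a version of the Wiener integral \<open>\<integral>\<^sub>a\<^sup>b f(s) dW\<^sub>s\<close> of the deterministic integrand \<open>f\<close>: the
  \<open>L\<^sup>2\<close>-limit of the integrals of step functions that approximate \<open>f\<close> in \<open>L\<^sup>2([a, b])\<close>. It is determined
  up to almost sure equality, so a process of such integrals is specified by a choice of versions.
\<close>

definition has_wiener_integral ::
    "'a measure \<Rightarrow> (real \<Rightarrow> 'a \<Rightarrow> real) \<Rightarrow> (real \<Rightarrow> real) \<Rightarrow> real \<Rightarrow> real \<Rightarrow> ('a \<Rightarrow> real) \<Rightarrow> bool" where
  "has_wiener_integral M W f a b X \<longleftrightarrow>
    set_borel_measurable lborel {a..b} f \<and> X \<in> borel_measurable M \<and>
    (\<exists>p :: nat \<Rightarrow> (real \<times> real \<times> real) list.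
      (\<forall>k. steps_in a b (p k)) \<and>
      (\<lambda>k. \<integral>\<^sup>+ s \<in> {a..b}. ennreal ((f s - step_fun (p k) s)\<^sup>2) \<partial>lborel) \<longlonglongrightarrow> 0 \<and>
      (\<lambda>k. \<integral>\<^sup>+ \<omega>. ennreal ((X \<omega> - step_wiener_integral W (p k) \<omega>)\<^sup>2) \<partial>M) \<longlonglongrightarrow> 0)"

text \<open>The Ornstein-Uhlenbeck process starting in 0, in its continuous version.\<close>

definition OU_process ::
    "'a measure \<Rightarrow> (real \<Rightarrow> 'a \<Rightarrow> real) \<Rightarrow> real \<Rightarrow> real \<Rightarrow> (real \<Rightarrow> 'a \<Rightarrow> real) \<Rightarrow> bool" where
  "OU_process M W q \<sigma> U \<longleftrightarrow>
    (\<forall>t\<ge>0. \<exists>I. has_wiener_integral M W (\<lambda>s. exp (q * (t - s))) 0 t I \<and>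
      (\<forall>\<omega>\<in>space M. U t \<omega> = \<sigma> * I \<omega>)) \<and>
    (\<forall>\<omega>\<in>space M. continuous_on {0..} (\<lambda>t. U t \<omega>))"

definition OU_bridge_av ::
    "real \<Rightarrow> real \<Rightarrow> real \<Rightarrow> (real \<Rightarrow> 'a \<Rightarrow> real) \<Rightarrow> real \<Rightarrow> 'a \<Rightarrow> real" where
  "OU_bridge_av q b T U\<^sub>0 t \<omega> =
    b * (sinh (q * t) / sinh (q * T)) + (U\<^sub>0 t \<omega> - sinh (q * t) / sinh (q * T) * U\<^sub>0 T \<omega>)"

text \<open>Continuity is only asked for on \<open>[0, T)\<close>, where the process is given by Wiener integrals.\<close>

definition OU_bridge_ir ::
    "'a measure \<Rightarrow> (real \<Rightarrow> 'a \<Rightarrow> real) \<Rightarrow> real \<Rightarrow> real \<Rightarrow> real \<Rightarrow> real \<Rightarrow> (real \<Rightarrow> 'a \<Rightarrow> real) \<Rightarrow> bool" where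
  "OU_bridge_ir M W q \<sigma> b T U \<longleftrightarrow>
    (\<forall>t. 0 \<le> t \<and> t < T \<longrightarrow>
      (\<exists>I. has_wiener_integral M W (\<lambda>s. sinh (q * (T - t)) / sinh (q * (T - s))) 0 t I \<and>
        (\<forall>\<omega>\<in>space M. U t \<omega> = b * (sinh (q * t) / sinh (q * T)) + \<sigma> * I \<omega>))) \<and>
    (\<forall>\<omega>\<in>space M. U T \<omega> = b) \<and>
    (\<forall>\<omega>\<in>space M. continuous_on {0..<T} (\<lambda>t. U t \<omega>))"

definition OU_kappa :: "real \<Rightarrow> real \<Rightarrow> real" where
  "OU_kappa q t = (1 - exp (- 2 * q * t)) / (2 * q)"

text \<open>
  As for the other two versions, the mean is \<open>b sinh(qt) / sinh(qT)\<close>, so the expected quadratic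
  distance to the Ornstein-Uhlenbeck process contains the summand
  \<open>b\<^sup>2/(4q) \<cdot> (sinh(2qT) - 2qT) / sinh\<^sup>2(qT)\<close> here as well. The published formula for this version
  omits that summand and is therefore only correct for \<open>b = 0\<close>; the theorem states the formula
  with the summand included.
\<close>

definition OU_bridge_st ::
    "(real \<Rightarrow> 'a \<Rightarrow> real) \<Rightarrow> real \<Rightarrow> real \<Rightarrow> real \<Rightarrow> real \<Rightarrow> real \<Rightarrow> 'a \<Rightarrow> real" where
  "OU_bridge_st W q \<sigma> b T t \<omega> =
    (if t < T then
       b * (sinh (q * t) / sinh (q * T)) +
       \<sigma> * exp (q * t) * ((OU_kappa q T - OU_kappa q t) / OU_kappa q T) *
         W (OU_kappa q t * OU_kappa q T / (OU_kappa q T - OU_kappa q t)) \<omega>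
     else b)"

end

theory Submission
  imports Defs
begin

text \<open>
  All three distances are second moments of Wiener integrals, integrated over time. The integrand
  is nonnegative, so by Fubini's theorem (\<open>expectation_time_integral\<close>) the expectation may be taken
  at each time separately; joint measurability comes from the continuity of the paths.

  At a fixed time, the process and the three bridges are, up to deterministic terms, linear
  combinations of Wiener integrals of explicit integrands. Their second moments are inner products in
  \<open>L\<^sup>2\<close> of the time axis by the isometry \<open>wiener_integral_inner\<close>: it holds for step functions because
  the covariance of two increments is the length of the intersection of their intervals, and it
  extends to \<open>L\<^sup>2\<close>-limits because the inner product is continuous.

  For the anticipative version, \<open>U\<^sub>0 t - U\<^sub>a\<^sub>v t = (U\<^sub>0 T - b) sinh (q t) / sinh (q T)\<close>, and the claim is
  immediate. The other two versions have the same mean and the same variance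
  \<open>\<sigma>\<^sup>2 sinh (q (T - t)) sinh (q t) / (q sinh (q T))\<close>, so their distances to the process differ only
  in the covariance with it (\<open>distance_bridge\<close>). For the integral representation, this covariance is
  \<open>\<sigma>\<^sup>2 / 2 (1 - exp (- 2 q (T - t))) (t + ln (sinh (q T) / sinh (q (T - t))) / q)\<close>, and the substitution
  \<open>x = q (T - t)\<close> produces the logarithmic integral of the claim. The space-time transform looks at
  \<open>W\<close> at a time that is at least \<open>t\<close> (\<open>time_le_space_time_clock\<close>), which gives the covariance
  \<open>\<sigma>\<^sup>2 sinh (q (T - t)) / sinh (q T) (exp (q t) - 1) / q\<close>.
\<close>

section \<open>Inner products of L2-limits\<close>

lemma real_Cauchy_Schwarz_integral:
  fixes f g :: "'a \<Rightarrow> real"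
  assumes [measurable]: "f \<in> borel_measurable M" "g \<in> borel_measurable M"
    and f: "integrable M (\<lambda>x. (f x)\<^sup>2)" and g: "integrable M (\<lambda>x. (g x)\<^sup>2)"
  shows "integrable M (\<lambda>x. f x * g x)"
    and "\<bar>\<integral>x. f x * g x \<partial>M\<bar> \<le> sqrt (\<integral>x. (f x)\<^sup>2 \<partial>M) * sqrt (\<integral>x. (g x)\<^sup>2 \<partial>M)"
proof -
  show int: "integrable M (\<lambda>x. f x * g x)"
  proof (rule Bochner_Integration.integrable_bound)
    show "integrable M (\<lambda>x. (f x)\<^sup>2 + (g x)\<^sup>2)" using f g by simp
    have "\<bar>a * b\<bar> \<le> a\<^sup>2 + b\<^sup>2" for a b :: real
      using sum_squares_bound[of "\<bar>a\<bar>" "\<bar>b\<bar>"] mult_nonneg_nonneg[of "\<bar>a\<bar>" "\<bar>b\<bar>"]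
      by (simp add: abs_mult del: mult_nonneg_nonneg)
    then show "AE x in M. norm (f x * g x) \<le> norm ((f x)\<^sup>2 + (g x)\<^sup>2)"
      by (simp add: abs_mult)
  qed simp
  have "(\<integral>\<^sup>+x. ennreal \<bar>f x\<bar> * ennreal \<bar>g x\<bar> \<partial>M)\<^sup>2
      \<le> (\<integral>\<^sup>+x. (ennreal \<bar>f x\<bar>)\<^sup>2 \<partial>M) * (\<integral>\<^sup>+x. (ennreal \<bar>g x\<bar>)\<^sup>2 \<partial>M)"
    by (rule Cauchy_Schwarz_nn_integral) auto
  also have "(\<integral>\<^sup>+x. ennreal \<bar>f x\<bar> * ennreal \<bar>g x\<bar> \<partial>M) = ennreal (\<integral>x. \<bar>f x * g x\<bar> \<partial>M)"
    using integrable_abs[OF int]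
    by (subst nn_integral_eq_integral[symmetric]) (auto simp: ennreal_mult abs_mult)
  also have "(\<integral>\<^sup>+x. (ennreal \<bar>f x\<bar>)\<^sup>2 \<partial>M) = ennreal (\<integral>x. (f x)\<^sup>2 \<partial>M)"
    using f by (subst nn_integral_eq_integral[symmetric]) (auto simp: ennreal_power)
  also have "(\<integral>\<^sup>+x. (ennreal \<bar>g x\<bar>)\<^sup>2 \<partial>M) = ennreal (\<integral>x. (g x)\<^sup>2 \<partial>M)"
    using g by (subst nn_integral_eq_integral[symmetric]) (auto simp: ennreal_power)
  finally have "(\<integral>x. \<bar>f x * g x\<bar> \<partial>M)\<^sup>2 \<le> (\<integral>x. (f x)\<^sup>2 \<partial>M) * (\<integral>x. (g x)\<^sup>2 \<partial>M)"
    by (simp add: ennreal_mult[symmetric] ennreal_power)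
  then have "(\<integral>x. \<bar>f x * g x\<bar> \<partial>M) \<le> sqrt ((\<integral>x. (f x)\<^sup>2 \<partial>M) * (\<integral>x. (g x)\<^sup>2 \<partial>M))"
    by (rule real_le_rsqrt)
  from order_trans[OF integral_abs_bound this] show "\<bar>\<integral>x. f x * g x \<partial>M\<bar> \<le> sqrt (\<integral>x. (f x)\<^sup>2 \<partial>M) * sqrt (\<integral>x. (g x)\<^sup>2 \<partial>M)"
    by (simp add: real_sqrt_mult)
qed

text \<open>
  The approximation is measured by a nonnegative integral, which may be infinite a priori. It is
  eventually below 1, so one approximant lies at finite distance from \<open>f\<close> and \<open>f\<close> inherits square
  integrability from it. Only then may the Bochner integral replace the nonnegative one.
\<close>

lemma L2_limit:
  fixes f :: "'a \<Rightarrow> real"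
  assumes [measurable]: "f \<in> borel_measurable M" "\<And>k. F k \<in> borel_measurable M"
    and F: "\<And>k. integrable M (\<lambda>x. (F k x)\<^sup>2)"
    and lim: "(\<lambda>k. \<integral>\<^sup>+x. ennreal ((f x - F k x)\<^sup>2) \<partial>M) \<longlonglongrightarrow> 0"
  shows "integrable M (\<lambda>x. (f x)\<^sup>2)"
    and "integrable M (\<lambda>x. (f x - F k x)\<^sup>2)"
    and "(\<lambda>k. \<integral>x. (f x - F k x)\<^sup>2 \<partial>M) \<longlonglongrightarrow> 0"
proof -
  from order_tendstoD(2)[OF lim, of 1] obtain k0 where
    "(\<integral>\<^sup>+x. ennreal ((f x - F k0 x)\<^sup>2) \<partial>M) < 1"
    by (auto simp: eventually_sequentially)
  then have k0: "integrable M (\<lambda>x. (f x - F k0 x)\<^sup>2)"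
    using order.strict_trans[OF _ ennreal_one_less_top]
    by (intro integrableI_bounded) (auto simp: )
  have sq: "\<bar>(a + b)\<^sup>2\<bar> \<le> 2 * a\<^sup>2 + 2 * b\<^sup>2" for a b :: real
    using sum_squares_bound[of a b] zero_le_power2[of "a + b"] by (simp only: power2_sum abs_of_nonneg)
  show f: "integrable M (\<lambda>x. (f x)\<^sup>2)"
  proof (rule Bochner_Integration.integrable_bound)
    show "integrable M (\<lambda>x. 2 * (f x - F k0 x)\<^sup>2 + 2 * (F k0 x)\<^sup>2)" using k0 F by simp
    show "AE x in M. norm ((f x)\<^sup>2) \<le> norm (2 * (f x - F k0 x)\<^sup>2 + 2 * (F k0 x)\<^sup>2)"
      using sq[of "f x - F k0 x" "F k0 x" for x] by auto
  qed simp
  show int: "integrable M (\<lambda>x. (f x - F k x)\<^sup>2)" for k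
  proof (rule Bochner_Integration.integrable_bound)
    show "integrable M (\<lambda>x. 2 * (f x)\<^sup>2 + 2 * (F k x)\<^sup>2)" using f F by simp
    show "AE x in M. norm ((f x - F k x)\<^sup>2) \<le> norm (2 * (f x)\<^sup>2 + 2 * (F k x)\<^sup>2)"
      using sq[of "f x" "- F k x" for x] by auto
  qed simp
  have "(\<lambda>k. ennreal (\<integral>x. (f x - F k x)\<^sup>2 \<partial>M)) \<longlonglongrightarrow> ennreal 0"
    using lim int by (simp add: nn_integral_eq_integral)
  then show "(\<lambda>k. \<integral>x. (f x - F k x)\<^sup>2 \<partial>M) \<longlonglongrightarrow> 0"
    by (subst (asm) tendsto_ennreal_iff) auto
qed

text \<open>
  Joint continuity of the inner product of \<open>L\<^sup>2\<close>. It is applied once on the probability space and once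
  on the time axis, which is how the isometry passes from step functions to general integrands.
\<close>

lemma L2_limit_mult:
  fixes f g :: "'a \<Rightarrow> real"
  assumes mf: "f \<in> borel_measurable M" "\<And>k. F k \<in> borel_measurable M"
    and mg: "g \<in> borel_measurable M" "\<And>k. G k \<in> borel_measurable M"
    and F: "\<And>k. integrable M (\<lambda>x. (F k x)\<^sup>2)" and G: "\<And>k. integrable M (\<lambda>x. (G k x)\<^sup>2)"
    and limF: "(\<lambda>k. \<integral>\<^sup>+x. ennreal ((f x - F k x)\<^sup>2) \<partial>M) \<longlonglongrightarrow> 0"
    and limG: "(\<lambda>k. \<integral>\<^sup>+x. ennreal ((g x - G k x)\<^sup>2) \<partial>M) \<longlonglongrightarrow> 0"
  shows "integrable M (\<lambda>x. f x * g x)"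
    and "(\<lambda>k. \<integral>x. F k x * G k x \<partial>M) \<longlonglongrightarrow> (\<integral>x. f x * g x \<partial>M)"
proof -
  note [measurable] = mf mg
  note Lf = L2_limit[OF mf F limF] and Lg = L2_limit[OF mg G limG]
  let ?n = "\<lambda>h. sqrt (\<integral>x. (h x)\<^sup>2 \<partial>M)"
  show int: "integrable M (\<lambda>x. f x * g x)"
    by (rule real_Cauchy_Schwarz_integral) (use Lf Lg in auto)
  have le: "\<bar>(\<integral>x. F k x * G k x \<partial>M) - (\<integral>x. f x * g x \<partial>M)\<bar> \<le>
      ?n (\<lambda>x. f x - F k x) * ?n g + ?n f * ?n (\<lambda>x. g x - G k x)
      + ?n (\<lambda>x. f x - F k x) * ?n (\<lambda>x. g x - G k x)" (is "_ \<le> ?B k") for k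
  proof -
    have i1: "integrable M (\<lambda>x. (f x - F k x) * g x)"
      and b1: "\<bar>\<integral>x. (f x - F k x) * g x \<partial>M\<bar> \<le> ?n (\<lambda>x. f x - F k x) * ?n g"
      by (rule real_Cauchy_Schwarz_integral; use Lf Lg in simp)+
    have i2: "integrable M (\<lambda>x. f x * (g x - G k x))"
      and b2: "\<bar>\<integral>x. f x * (g x - G k x) \<partial>M\<bar> \<le> ?n f * ?n (\<lambda>x. g x - G k x)"
      by (rule real_Cauchy_Schwarz_integral; use Lf Lg in simp)+
    have i3: "integrable M (\<lambda>x. (f x - F k x) * (g x - G k x))"
      and b3: "\<bar>\<integral>x. (f x - F k x) * (g x - G k x) \<partial>M\<bar>
        \<le> ?n (\<lambda>x. f x - F k x) * ?n (\<lambda>x. g x - G k x)"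
      by (rule real_Cauchy_Schwarz_integral; use Lf Lg in simp)+
    \<comment> \<open>expand \<open>F k * G k\<close> around \<open>f * g\<close>; each of the three error terms contains a factor tending to 0\<close>
    have "(\<integral>x. F k x * G k x \<partial>M) = (\<integral>x. f x * g x - (f x - F k x) * g x - f x * (g x - G k x)
        + (f x - F k x) * (g x - G k x) \<partial>M)"
      by (rule Bochner_Integration.integral_cong) (auto simp: algebra_simps)
    also have "\<dots> = (\<integral>x. f x * g x \<partial>M) - (\<integral>x. (f x - F k x) * g x \<partial>M)
        - (\<integral>x. f x * (g x - G k x) \<partial>M) + (\<integral>x. (f x - F k x) * (g x - G k x) \<partial>M)"
      using int i1 i2 i3 by simp
    finally show ?thesis using b1 b2 b3 by linarith
  qed
  have "?B \<longlonglongrightarrow> sqrt 0 * ?n g + ?n f * sqrt 0 + sqrt 0 * sqrt 0"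
    using Lf(3) Lg(3) by (intro tendsto_intros)
  then have "?B \<longlonglongrightarrow> 0" by simp
  then have "(\<lambda>k. (\<integral>x. F k x * G k x \<partial>M) - (\<integral>x. f x * g x \<partial>M)) \<longlonglongrightarrow> 0"
    by (rule Lim_null_comparison[rotated]) (use le in simp)
  then show "(\<lambda>k. \<integral>x. F k x * G k x \<partial>M) \<longlonglongrightarrow> (\<integral>x. f x * g x \<partial>M)"
    by (rule LIM_zero_cancel)
qed

text \<open>
  Products of list sums occur in the same shape for step functions and for their Wiener integrals,
  with the same table \<open>C\<close> of inner products of the summands; the isometry on step functions is then a
  comparison of these tables.
\<close>

lemma has_bochner_integral_sum_list_mult:
  fixes f :: "'b \<Rightarrow> 'a \<Rightarrow> real" and g :: "'c \<Rightarrow> 'a \<Rightarrow> real"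
  assumes "\<And>p p'. p \<in> set ps \<Longrightarrow> p' \<in> set ps' \<Longrightarrow>
    has_bochner_integral M (\<lambda>x. f p x * g p' x) (C p p')"
  shows "has_bochner_integral M (\<lambda>x. (\<Sum>p\<leftarrow>ps. f p x) * (\<Sum>p'\<leftarrow>ps'. g p' x))
    (\<Sum>p\<leftarrow>ps. \<Sum>p'\<leftarrow>ps'. C p p')"
proof -
  have inner: "has_bochner_integral M (\<lambda>x. f p x * (\<Sum>p'\<leftarrow>qs. g p' x)) (\<Sum>p'\<leftarrow>qs. C p p')"
    if "p \<in> set ps" "set qs \<subseteq> set ps'" for p qs
    using that(2)
  proof (induction qs)
    case (Cons q qs)
    have "has_bochner_integral M (\<lambda>x. f p x * g q x) (C p q)"
      using Cons.prems that(1) by (intro assms) auto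
    from has_bochner_integral_add[OF this Cons.IH] Cons.prems show ?case
      by (simp add: distrib_left)
  qed (simp add: has_bochner_integral_zero)
  have "has_bochner_integral M (\<lambda>x. (\<Sum>p\<leftarrow>rs. f p x) * (\<Sum>p'\<leftarrow>ps'. g p' x))
      (\<Sum>p\<leftarrow>rs. \<Sum>p'\<leftarrow>ps'. C p p')" if "set rs \<subseteq> set ps" for rs
    using that
  proof (induction rs)
    case (Cons r rs)
    from has_bochner_integral_add[OF inner[of r ps', OF _ order.refl] Cons.IH] Cons.prems
    show ?case by (simp add: distrib_right)
  qed (simp add: has_bochner_integral_zero)
  then show ?thesis by simp
qed

section \<open>Increments of the Wiener process and step functions\<close>

context wiener_process
begin

lemma measurable_increment:
  "0 \<le> s \<Longrightarrow> 0 \<le> t \<Longrightarrow> (\<lambda>\<omega>. W t \<omega> - W s \<omega>) \<in> borel_measurable M"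
  by (intro borel_measurable_diff measurable_W)

lemma increment_moments:
  assumes "0 \<le> s" "s \<le> t"
  shows "has_bochner_integral M (\<lambda>\<omega>. W t \<omega> - W s \<omega>) 0"
    and "has_bochner_integral M (\<lambda>\<omega>. (W t \<omega> - W s \<omega>)\<^sup>2) (t - s)"
proof -
  let ?X = "\<lambda>\<omega>. W t \<omega> - W s \<omega>"
  have "has_bochner_integral M ?X 0 \<and> has_bochner_integral M (\<lambda>\<omega>. (?X \<omega>)\<^sup>2) (t - s)"
  proof (cases "s < t")
    case True
    then have D: "distributed M lborel ?X (normal_density 0 (sqrt (t - s)))"
      using normal_increments assms by simp
    have pos: "0 < sqrt (t - s)" using True by simp
    have i1: "integrable M ?X"
      using integrable_normal_moment[OF pos, of 0 1]
      by (intro distributed_integrable_var[OF D]) (auto simp: normal_density_nonneg)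
    have i2: "integrable M (\<lambda>\<omega>. (?X \<omega>)\<^sup>2)"
      using integrable_normal_moment[OF pos, of 0 2]
      by (subst distributed_integrable[OF D, of "\<lambda>x. x\<^sup>2", symmetric])
        (auto simp: normal_density_nonneg)
    have "expectation ?X = 0" using normal_distributed_expectation[OF pos D] .
    with normal_distributed_variance[OF pos D] True
    show ?thesis using i1 i2 by (simp add: has_bochner_integral_iff)
  qed (use assms in auto)
  then show "has_bochner_integral M ?X 0" "has_bochner_integral M (\<lambda>\<omega>. (?X \<omega>)\<^sup>2) (t - s)"
    by auto
qed

lemma adjacent_increments_uncorrelated:
  assumes "0 \<le> r" "r \<le> s" "s \<le> t"
  shows "has_bochner_integral M (\<lambda>\<omega>. (W s \<omega> - W r \<omega>) * (W t \<omega> - W s \<omega>)) 0"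
proof (cases "r < s \<and> s < t")
  case True
  define \<tau> where "\<tau> i = (if i = 0 then r else if i = 1 then s else t)" for i :: nat
  define X where "X i \<omega> = W (\<tau> (Suc i)) \<omega> - W (\<tau> i) \<omega>" for i \<omega>
  have indep: "indep_vars (\<lambda>_. borel) X {..<2}"
    unfolding X_def using True assms(1)
    by (intro indep_increments) (auto simp: \<tau>_def less_2_cases_iff)
  have X: "X 0 = (\<lambda>\<omega>. W s \<omega> - W r \<omega>)" "X 1 = (\<lambda>\<omega>. W t \<omega> - W s \<omega>)"
    by (auto simp: X_def \<tau>_def)
  have int: "integrable M (X i)" if "i \<in> {..<2}" for i
    using that increment_moments(1)[of r s] increment_moments(1)[of s t] assms X
    by (auto simp: less_2_cases_iff has_bochner_integral_iff)
  have two: "{..<2::nat} = {0, 1}" by auto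
  have "integrable M (\<lambda>\<omega>. \<Prod>i\<in>{..<2}. X i \<omega>)"
    using indep_vars_integrable[OF _ indep int] by simp
  moreover have "(\<integral>\<omega>. (\<Prod>i\<in>{..<2}. X i \<omega>) \<partial>M) = (\<Prod>i\<in>{..<2}. expectation (X i))"
    using indep_vars_lebesgue_integral[OF _ indep int] by simp
  moreover have "expectation (X 0) = 0"
    using increment_moments(1)[of r s] assms X by (simp add: has_bochner_integral_iff)
  ultimately show ?thesis
    by (simp add: two X[unfolded One_nat_def] has_bochner_integral_iff)
qed (use assms in auto)

text \<open>
  Covariances are computed for \<open>W t - W 0\<close> instead of \<open>W t\<close>: increments are insensitive to the
  starting value, and so no null set has to be excluded where \<open>W 0\<close> differs from 0. For \<open>s \<le> t\<close> the
  later value splits into the earlier one and an uncorrelated increment.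
\<close>

lemma covariance_from_start:
  assumes "0 \<le> s" "0 \<le> t"
  shows "has_bochner_integral M (\<lambda>\<omega>. (W s \<omega> - W 0 \<omega>) * (W t \<omega> - W 0 \<omega>)) (min s t)"
proof -
  have *: "has_bochner_integral M (\<lambda>\<omega>. (W s \<omega> - W 0 \<omega>) * (W t \<omega> - W 0 \<omega>)) s"
    if "0 \<le> s" "s \<le> t" for s t
  proof -
    have "has_bochner_integral M (\<lambda>\<omega>. (W s \<omega> - W 0 \<omega>)\<^sup>2 +
        (W s \<omega> - W 0 \<omega>) * (W t \<omega> - W s \<omega>)) (s - 0 + 0)"
      using that
      by (intro has_bochner_integral_add increment_moments adjacent_increments_uncorrelated) auto
    also have "(\<lambda>\<omega>. (W s \<omega> - W 0 \<omega>)\<^sup>2 + (W s \<omega> - W 0 \<omega>) * (W t \<omega> - W s \<omega>)) =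
        (\<lambda>\<omega>. (W s \<omega> - W 0 \<omega>) * (W t \<omega> - W 0 \<omega>))"
      by (auto simp: power2_eq_square algebra_simps)
    finally show ?thesis by simp
  qed
  show ?thesis
    using *[of s t] *[of t s] assms by (cases "s \<le> t") (auto simp: mult.commute)
qed

text \<open>
  By bilinearity from the previous lemma. The value is the length of
  \<open>{u<..v} \<inter> {u'<..v'}\<close>, also when the two intervals overlap partially or not at all.
\<close>

lemma increment_covariance:
  assumes "0 \<le> u" "u \<le> v" "0 \<le> u'" "u' \<le> v'"
  shows "has_bochner_integral M (\<lambda>\<omega>. (W v \<omega> - W u \<omega>) * (W v' \<omega> - W u' \<omega>))
    (max 0 (min v v' - max u u'))"
proof -
  let ?D = "\<lambda>s \<omega>. W s \<omega> - W 0 \<omega>"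
  have "has_bochner_integral M (\<lambda>\<omega>. ?D v \<omega> * ?D v' \<omega> - ?D v \<omega> * ?D u' \<omega> -
      ?D u \<omega> * ?D v' \<omega> + ?D u \<omega> * ?D u' \<omega>) (min v v' - min v u' - min u v' + min u u')"
    using assms
    by (intro has_bochner_integral_add has_bochner_integral_diff covariance_from_start) auto
  also have "(\<lambda>\<omega>. ?D v \<omega> * ?D v' \<omega> - ?D v \<omega> * ?D u' \<omega> - ?D u \<omega> * ?D v' \<omega> + ?D u \<omega> * ?D u' \<omega>) =
      (\<lambda>\<omega>. (W v \<omega> - W u \<omega>) * (W v' \<omega> - W u' \<omega>))"
    by (auto simp: algebra_simps)
  also have "min v v' - min v u' - min u v' + min u u' = max 0 (min v v' - max u u')"
    using assms by (auto simp: min_def max_def)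
  finally show ?thesis .
qed

end

lemma indicator_Ioc_inner:
  fixes u v u' v' :: real
  shows "has_bochner_integral lborel (\<lambda>s. indicator {u<..v} s * indicator {u'<..v'} s :: real)
    (max 0 (min v v' - max u u'))"
proof -
  have "(\<lambda>s. indicator {u<..v} s * indicator {u'<..v'} s :: real) =
      indicator ({max u u'<..min v v'})"
    by (auto simp: indicator_def fun_eq_iff)
  moreover have "measure lborel {max u u'<..min v v'} = max 0 (min v v' - max u u')"
  proof (cases "max u u' \<le> min v v'")
    case False
    then have empty: "{max u u'<..min v v'} = {}" by auto
    have "min v v' - max u u' \<le> 0" using False by linarith
    then show ?thesis unfolding empty by (simp only: max_absorb1 measure_empty)
  next
    case True
    then show ?thesis
      by (subst measure_lborel_Ioc) (auto simp: max_absorb2 simp del: max.bounded_iff min.bounded_iff)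
  qed
  moreover have "emeasure lborel {max u u'<..min v v'} < \<infinity>"
    by (rule le_less_trans[OF emeasure_mono[of _ "{max u u'..min v v'}"]])
      (auto simp: emeasure_lborel_Icc_eq)
  ultimately show ?thesis
    using has_bochner_integral_real_indicator[of "{max u u'<..min v v'}" lborel] by simp
qed

lemma step_fun_measurable [measurable]: "step_fun ps \<in> borel_measurable borel"
proof (induction ps)
  case (Cons p ps)
  obtain c u v where "p = (c, u, v)" by (cases p)
  then have "step_fun (p # ps) = (\<lambda>s. c * indicator {u<..v} s + step_fun ps s)"
    by (auto simp: step_fun_def)
  with Cons show ?case by simp
qed (simp add: step_fun_def[abs_def])

lemma step_fun_outside:
  assumes "steps_in a b ps" "s \<notin> {a..b}"
  shows "step_fun ps s = 0"
  using assms(1)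
proof (induction ps)
  case (Cons p ps)
  then show ?case
    using assms(2) by (cases p) (auto simp: step_fun_def steps_in_def indicator_def)
qed (simp add: step_fun_def)

lemma (in wiener_process) step_wiener_integral_measurable:
  "0 \<le> a \<Longrightarrow> steps_in a b ps \<Longrightarrow> step_wiener_integral W ps \<in> borel_measurable M"
proof (induction ps)
  case (Cons p ps)
  obtain c u v where p: "p = (c, u, v)" by (cases p)
  then have "step_wiener_integral W (p # ps) =
      (\<lambda>\<omega>. c * (W v \<omega> - W u \<omega>) + step_wiener_integral W ps \<omega>)"
    by (auto simp: step_wiener_integral_def)
  moreover have "steps_in a b ps" "0 \<le> u" "0 \<le> v" using Cons.prems p by (auto simp: steps_in_def)
  ultimately show ?case using Cons measurable_increment by simp
qed (simp add: step_wiener_integral_def[abs_def])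

text \<open>
  The inner product of two step functions in \<open>L\<^sup>2\<close>, read off from the lists that represent them.
\<close>

definition step_inner :: "(real \<times> real \<times> real) list \<Rightarrow> (real \<times> real \<times> real) list \<Rightarrow> real" where
  "step_inner ps ps' =
    (\<Sum>(c, u, v)\<leftarrow>ps. \<Sum>(c', u', v')\<leftarrow>ps'. c * c' * max 0 (min v v' - max u u'))"

lemma step_fun_inner:
  "has_bochner_integral lborel (\<lambda>s. step_fun ps s * step_fun ps' s) (step_inner ps ps')"
  unfolding step_fun_def step_inner_def split_beta
proof (rule has_bochner_integral_sum_list_mult)
  fix p p' :: "real \<times> real \<times> real"
  obtain c u v c' u' v' where p: "p = (c, u, v)" "p' = (c', u', v')" by (cases p, cases p')
  show "has_bochner_integral lborel
      (\<lambda>x. fst p * indicator {fst (snd p)<..snd (snd p)} x *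
        (fst p' * indicator {fst (snd p')<..snd (snd p')} x))
      (fst p * fst p' * max 0 (min (snd (snd p)) (snd (snd p')) - max (fst (snd p)) (fst (snd p'))))"
    using has_bochner_integral_mult_right[OF indicator_Ioc_inner[of u v u' v'], of "c * c'"]
    by (simp add: p mult_ac)
qed

lemma (in wiener_process) step_wiener_integral_inner:
  assumes "0 \<le> a" "0 \<le> a'" "steps_in a b ps" "steps_in a' b' ps'"
  shows "has_bochner_integral M
    (\<lambda>\<omega>. step_wiener_integral W ps \<omega> * step_wiener_integral W ps' \<omega>) (step_inner ps ps')"
  unfolding step_wiener_integral_def step_inner_def split_beta
proof (rule has_bochner_integral_sum_list_mult)
  fix p p' assume in_ps: "p \<in> set ps" "p' \<in> set ps'"
  obtain c u v c' u' v' where p: "p = (c, u, v)" "p' = (c', u', v')" by (cases p, cases p')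
  have "0 \<le> u" "u \<le> v" "0 \<le> u'" "u' \<le> v'"
    using assms in_ps p by (auto simp: steps_in_def)
  from has_bochner_integral_mult_right[OF increment_covariance[OF this], of "c * c'"]
  show "has_bochner_integral M
      (\<lambda>x. fst p * (W (snd (snd p)) x - W (fst (snd p)) x) *
        (fst p' * (W (snd (snd p')) x - W (fst (snd p')) x)))
      (fst p * fst p' * max 0 (min (snd (snd p)) (snd (snd p')) - max (fst (snd p)) (fst (snd p'))))"
    by (simp add: p mult_ac)
qed

lemma (in wiener_process) step_wiener_integral_mean:
  "0 \<le> a \<Longrightarrow> steps_in a b ps \<Longrightarrow> has_bochner_integral M (step_wiener_integral W ps) 0"
proof (induction ps)
  case (Cons p ps)
  obtain c u v where p: "p = (c, u, v)" by (cases p)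
  have uv: "steps_in a b ps" "0 \<le> u" "u \<le> v" using Cons.prems p by (auto simp: steps_in_def)
  from p have "step_wiener_integral W (p # ps) =
      (\<lambda>\<omega>. c * (W v \<omega> - W u \<omega>) + step_wiener_integral W ps \<omega>)"
    by (auto simp: step_wiener_integral_def)
  with has_bochner_integral_add[OF
      has_bochner_integral_mult_right[OF increment_moments(1)[OF uv(2,3)], of c] Cons.IH] uv Cons.prems
  show ?case by simp
qed (simp add: step_wiener_integral_def[abs_def] has_bochner_integral_zero)

section \<open>The isometry of the Wiener integral\<close>

text \<open>
  The integrand is cut off outside \<open>[a, b]\<close>, where the approximating step functions vanish. Integrals
  over different intervals thereby live in the same space \<open>L\<^sup>2(\<real>)\<close>.
\<close>

lemma has_wiener_integral_L2:
  assumes "has_wiener_integral M W f a b X"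
  obtains p where "X \<in> borel_measurable M" "(\<lambda>s. indicator {a..b} s * f s) \<in> borel_measurable lborel"
    "\<And>k. steps_in a b (p k)"
    "(\<lambda>k. \<integral>\<^sup>+ s. ennreal ((indicator {a..b} s * f s - step_fun (p k) s)\<^sup>2) \<partial>lborel) \<longlonglongrightarrow> 0"
    "(\<lambda>k. \<integral>\<^sup>+ \<omega>. ennreal ((X \<omega> - step_wiener_integral W (p k) \<omega>)\<^sup>2) \<partial>M) \<longlonglongrightarrow> 0"
proof -
  from assms obtain p where p: "\<And>k. steps_in a b (p k)"
    "(\<lambda>k. \<integral>\<^sup>+ s \<in> {a..b}. ennreal ((f s - step_fun (p k) s)\<^sup>2) \<partial>lborel) \<longlonglongrightarrow> 0"
    "(\<lambda>k. \<integral>\<^sup>+ \<omega>. ennreal ((X \<omega> - step_wiener_integral W (p k) \<omega>)\<^sup>2) \<partial>M) \<longlonglongrightarrow> 0"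
    unfolding has_wiener_integral_def by blast
  have "(\<integral>\<^sup>+ s \<in> {a..b}. ennreal ((f s - step_fun (p k) s)\<^sup>2) \<partial>lborel) =
      (\<integral>\<^sup>+ s. ennreal ((indicator {a..b} s * f s - step_fun (p k) s)\<^sup>2) \<partial>lborel)" for k
    using step_fun_outside[OF p(1)]
    by (intro nn_integral_cong) (auto split: split_indicator)
  with that[of p] p assms show thesis
    by (simp add: has_wiener_integral_def set_borel_measurable_def)
qed

context wiener_process
begin

text \<open>
  The isometry of the Wiener integral, in polarised form. For the approximating step functions
  both sides equal \<open>step_inner\<close>, and both sides pass to the limit by \<open>L2_limit_mult\<close>.
\<close>

proposition wiener_integral_inner:
  assumes f: "has_wiener_integral M W f a b X" and g: "has_wiener_integral M W g c d Y"
    and "0 \<le> a" "0 \<le> c"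
  shows "has_bochner_integral M (\<lambda>\<omega>. X \<omega> * Y \<omega>)
    (\<integral>s. (indicator {a..b} s * f s) * (indicator {c..d} s * g s) \<partial>lborel)"
proof -
  obtain p where X: "X \<in> borel_measurable M"
    "(\<lambda>s. indicator {a..b} s * f s) \<in> borel_measurable lborel"
    and p: "\<And>k. steps_in a b (p k)"
    "(\<lambda>k. \<integral>\<^sup>+ s. ennreal ((indicator {a..b} s * f s - step_fun (p k) s)\<^sup>2) \<partial>lborel) \<longlonglongrightarrow> 0"
    "(\<lambda>k. \<integral>\<^sup>+ \<omega>. ennreal ((X \<omega> - step_wiener_integral W (p k) \<omega>)\<^sup>2) \<partial>M) \<longlonglongrightarrow> 0"
    by (rule has_wiener_integral_L2[OF f]) blast
  obtain q where Y: "Y \<in> borel_measurable M"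
    "(\<lambda>s. indicator {c..d} s * g s) \<in> borel_measurable lborel"
    and q: "\<And>k. steps_in c d (q k)"
    "(\<lambda>k. \<integral>\<^sup>+ s. ennreal ((indicator {c..d} s * g s - step_fun (q k) s)\<^sup>2) \<partial>lborel) \<longlonglongrightarrow> 0"
    "(\<lambda>k. \<integral>\<^sup>+ \<omega>. ennreal ((Y \<omega> - step_wiener_integral W (q k) \<omega>)\<^sup>2) \<partial>M) \<longlonglongrightarrow> 0"
    by (rule has_wiener_integral_L2[OF g]) blast
  note SW = step_wiener_integral_measurable[OF \<open>0 \<le> a\<close> p(1)]
    step_wiener_integral_measurable[OF \<open>0 \<le> c\<close> q(1)]
  have sqX: "integrable M (\<lambda>\<omega>. (step_wiener_integral W (p k) \<omega>)\<^sup>2)" for k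
    using step_wiener_integral_inner[OF assms(3,3) p(1) p(1)]
    by (auto simp: power2_eq_square has_bochner_integral_iff)
  have sqY: "integrable M (\<lambda>\<omega>. (step_wiener_integral W (q k) \<omega>)\<^sup>2)" for k
    using step_wiener_integral_inner[OF assms(4,4) q(1) q(1)]
    by (auto simp: power2_eq_square has_bochner_integral_iff)
  have sqf: "integrable lborel (\<lambda>\<omega>. (step_fun r \<omega>)\<^sup>2)" for r
    using step_fun_inner[of r r] by (auto simp: power2_eq_square has_bochner_integral_iff)
  have int: "integrable M (\<lambda>\<omega>. X \<omega> * Y \<omega>)"
    by (rule L2_limit_mult(1)[OF X(1) SW(1) Y(1) SW(2) sqX sqY p(3) q(3)])
  have "(\<lambda>k. step_inner (p k) (q k)) \<longlonglongrightarrow> expectation (\<lambda>\<omega>. X \<omega> * Y \<omega>)"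
    using L2_limit_mult(2)[OF X(1) SW(1) Y(1) SW(2) sqX sqY p(3) q(3)]
      step_wiener_integral_inner[OF assms(3,4) p(1) q(1)]
    by (simp add: has_bochner_integral_iff)
  moreover have "(\<lambda>k. step_inner (p k) (q k)) \<longlonglongrightarrow>
      (\<integral>s. (indicator {a..b} s * f s) * (indicator {c..d} s * g s) \<partial>lborel)"
    using L2_limit_mult(2)[OF X(2) _ Y(2) _ sqf sqf p(2) q(2)] step_fun_inner
    by (simp add: has_bochner_integral_iff)
  ultimately show ?thesis
    using int LIMSEQ_unique by (auto simp: has_bochner_integral_iff)
qed

text \<open>
  On a probability space, the mean is the inner product with the constant 1, so it is continuous in
  \<open>L\<^sup>2\<close> as well.
\<close>

lemma wiener_integral_mean:
  assumes f: "has_wiener_integral M W f a b X" and "0 \<le> a"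
  shows "has_bochner_integral M X 0"
proof -
  obtain p where X: "X \<in> borel_measurable M"
    and p: "\<And>k. steps_in a b (p k)"
    "(\<lambda>k. \<integral>\<^sup>+ \<omega>. ennreal ((X \<omega> - step_wiener_integral W (p k) \<omega>)\<^sup>2) \<partial>M) \<longlonglongrightarrow> 0"
    by (rule has_wiener_integral_L2[OF f]) blast
  have sqX: "integrable M (\<lambda>\<omega>. (step_wiener_integral W (p k) \<omega>)\<^sup>2)" for k
    using step_wiener_integral_inner[OF assms(2,2) p(1) p(1)]
    by (auto simp: power2_eq_square has_bochner_integral_iff)
  note L = L2_limit_mult[OF X(1) step_wiener_integral_measurable[OF \<open>0 \<le> a\<close> p(1)] _ _ sqX _ p(2),
      where g = "\<lambda>_. 1" and G = "\<lambda>_ _. 1"]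
  have "integrable M (\<lambda>\<omega>. X \<omega> * 1)"
    by (rule L) auto
  moreover have "(\<lambda>k. expectation (\<lambda>\<omega>. step_wiener_integral W (p k) \<omega> * 1)) \<longlonglongrightarrow> expectation (\<lambda>\<omega>. X \<omega> * 1)"
    by (rule L) auto
  ultimately have lim: "integrable M X" "(\<lambda>k. expectation (step_wiener_integral W (p k))) \<longlonglongrightarrow> expectation X"
    by simp_all
  have "expectation (step_wiener_integral W (p k)) = 0" for k
    using step_wiener_integral_mean[OF \<open>0 \<le> a\<close> p(1)] by (simp add: has_bochner_integral_iff)
  with lim(2) have "expectation X = 0" by (simp add: LIMSEQ_const_iff)
  with lim(1) show ?thesis by (simp add: has_bochner_integral_iff)
qed

text \<open>
  This makes the values of \<open>W\<close> that occur in the space-time transform accessible to the isometry. The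
  integrand 1 differs from its step function at the point 0, and \<open>W r\<close> differs from \<open>W r - W 0\<close> on a
  null set.
\<close>

lemma has_wiener_integral_one:
  assumes "0 \<le> r"
  shows "has_wiener_integral M W (\<lambda>_. 1) 0 r (W r)"
  unfolding has_wiener_integral_def
proof (intro conjI exI[of _ "\<lambda>_::nat. [(1, 0, r)]"] allI)
  show "W r \<in> borel_measurable M" using assms by (rule measurable_W)
  show "steps_in 0 r [(1, 0, r)]" using assms by (simp add: steps_in_def)
  have "(\<integral>\<^sup>+ s\<in>{0..r}. ennreal ((1 - step_fun [(1, 0, r)] s)\<^sup>2) \<partial>lborel) = (\<integral>\<^sup>+ s. 0 \<partial>(lborel::real measure))"
    by (rule nn_integral_cong_AE)
      (use AE_lborel_singleton[of "0::real"] in eventually_elim,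
        auto simp: step_fun_def split: split_indicator)
  then show "(\<lambda>k. \<integral>\<^sup>+ s\<in>{0..r}. ennreal ((1 - step_fun [(1, 0, r)] s)\<^sup>2) \<partial>lborel) \<longlonglongrightarrow> 0"
    by simp
  have "(\<integral>\<^sup>+ \<omega>. ennreal ((W r \<omega> - step_wiener_integral W [(1, 0, r)] \<omega>)\<^sup>2) \<partial>M) = (\<integral>\<^sup>+ \<omega>. 0 \<partial>M)"
    by (rule nn_integral_cong_AE)
      (use W_zero in eventually_elim, auto simp: step_wiener_integral_def)
  then show "(\<lambda>k. \<integral>\<^sup>+ \<omega>. ennreal ((W r \<omega> - step_wiener_integral W [(1, 0, r)] \<omega>)\<^sup>2) \<partial>M) \<longlonglongrightarrow> 0"
    by simp
qed (simp add: set_borel_measurable_def)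

text \<open>
  The form in which the isometry enters the three distances: the process and the bridge are
  combinations of two Wiener integrals and a deterministic term. Since \<open>t \<le> r\<close>, the two integrals
  interact on \<open>[0, t]\<close> only; the mixed terms with the constant vanish by centredness.
\<close>

lemma wiener_integrals_second_moment:
  assumes f: "has_wiener_integral M W f 0 t X" and g: "has_wiener_integral M W g 0 r Y"
    and ff: "has_bochner_integral lborel (\<lambda>s. (f s)\<^sup>2 * indicator {0..t} s) A"
    and fg: "has_bochner_integral lborel (\<lambda>s. f s * g s * indicator {0..t} s) B"
    and gg: "has_bochner_integral lborel (\<lambda>s. (g s)\<^sup>2 * indicator {0..r} s) C"
    and "t \<le> r"
  shows "has_bochner_integral M (\<lambda>\<omega>. (x * X \<omega> + y * Y \<omega> + m)\<^sup>2)
    (x\<^sup>2 * A + 2 * x * y * B + y\<^sup>2 * C + m\<^sup>2)"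
proof -
  have "(\<lambda>s. (indicator {0..t} s * f s) * (indicator {0..t} s * f s)) =
      (\<lambda>s. (f s)\<^sup>2 * indicator {0..t} s)"
    by (auto simp: power2_eq_square split: split_indicator)
  with wiener_integral_inner[OF f f] ff
  have XX: "has_bochner_integral M (\<lambda>\<omega>. X \<omega> * X \<omega>) A"
    by (simp add: has_bochner_integral_iff)
  have "(\<lambda>s. (indicator {0..t} s * f s) * (indicator {0..r} s * g s)) =
      (\<lambda>s. f s * g s * indicator {0..t} s)"
    using \<open>t \<le> r\<close> by (auto split: split_indicator)
  with wiener_integral_inner[OF f g] fg
  have XY: "has_bochner_integral M (\<lambda>\<omega>. X \<omega> * Y \<omega>) B"
    by (simp add: has_bochner_integral_iff)
  have "(\<lambda>s. (indicator {0..r} s * g s) * (indicator {0..r} s * g s)) =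
      (\<lambda>s. (g s)\<^sup>2 * indicator {0..r} s)"
    by (auto simp: power2_eq_square split: split_indicator)
  with wiener_integral_inner[OF g g] gg
  have YY: "has_bochner_integral M (\<lambda>\<omega>. Y \<omega> * Y \<omega>) C"
    by (simp add: has_bochner_integral_iff)
  have const: "has_bochner_integral M (\<lambda>\<omega>. m\<^sup>2) (m\<^sup>2)"
    by (simp add: has_bochner_integral_iff prob_space)
  have "has_bochner_integral M (\<lambda>\<omega>. x\<^sup>2 * (X \<omega> * X \<omega>) + 2 * x * y * (X \<omega> * Y \<omega>) + y\<^sup>2 * (Y \<omega> * Y \<omega>)
      + 2 * x * m * X \<omega> + 2 * y * m * Y \<omega> + m\<^sup>2)
      (x\<^sup>2 * A + 2 * x * y * B + y\<^sup>2 * C + 2 * x * m * 0 + 2 * y * m * 0 + m\<^sup>2)"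
    using XX XY YY const wiener_integral_mean[OF f] wiener_integral_mean[OF g]
    by (intro has_bochner_integral_add has_bochner_integral_mult_right) auto
  then show ?thesis by (simp add: power2_eq_square algebra_simps)
qed

end

section \<open>Exchanging expectation and time integral\<close>

text \<open>
  A process with continuous paths is jointly measurable, because it is the pointwise limit of the
  processes that are frozen at the last time of a grid of mesh \<open>1 / (n + 1)\<close>. Rounding downwards
  keeps the frozen time in \<open>[0, T)\<close>, where the paths are continuous.
\<close>

lemma borel_measurable_continuous_paths:
  fixes Y :: "real \<Rightarrow> 'a \<Rightarrow> real"
  assumes meas: "\<And>t. 0 \<le> t \<Longrightarrow> t < T \<Longrightarrow> Y t \<in> borel_measurable M"
    and cont: "\<And>\<omega>. \<omega> \<in> space M \<Longrightarrow> continuous_on {0..<T} (\<lambda>t. Y t \<omega>)"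
  shows "(\<lambda>(t, \<omega>). indicator {0<..<T} t * Y t \<omega>) \<in> borel_measurable (lborel \<Otimes>\<^sub>M M)"
proof -
  define g where "g n t = real_of_int \<lfloor>real (Suc n) * t\<rfloor> / real (Suc n)" for n t
  have g_le: "g n t \<le> t" for n t
    by (simp add: g_def divide_le_eq mult.commute)
  have g_ge: "0 \<le> g n t" if "0 \<le> t" for n t
    using that by (simp add: g_def)
  have g_lim: "(\<lambda>n. g n t) \<longlonglongrightarrow> t" for t
  proof (rule tendsto_sandwich[OF _ _ _ tendsto_const])
    show "\<forall>\<^sub>F n in sequentially. t - 1 / real (Suc n) \<le> g n t"
    proof (intro always_eventually allI)
      fix n
      have "real (Suc n) * t - 1 \<le> real_of_int \<lfloor>real (Suc n) * t\<rfloor>" by linarith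
      then have "(real (Suc n) * t - 1) / real (Suc n) \<le> g n t"
        unfolding g_def by (rule divide_right_mono) simp
      then show "t - 1 / real (Suc n) \<le> g n t" by (simp add: diff_divide_distrib)
    qed
    show "(\<lambda>n. t - 1 / real (Suc n)) \<longlonglongrightarrow> t"
      using tendsto_diff[OF tendsto_const[of t] lim_inverse_n'[THEN LIMSEQ_Suc]] by simp
  qed (simp add: g_le)
  \<comment> \<open>the value 0 at other times \<open>c\<close> makes \<open>V c\<close> measurable for every real \<open>c\<close>\<close>
  define V where "V c = (\<lambda>(t::real, \<omega>). if 0 \<le> c \<and> c < T then indicator {0<..<T} t * Y c \<omega> else 0)" for c
  have V: "V c \<in> borel_measurable (lborel \<Otimes>\<^sub>M M)" for c
  proof (cases "0 \<le> c \<and> c < T")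
    case True
    then have [measurable]: "Y c \<in> borel_measurable M" using meas by simp
    show ?thesis using True by (simp add: V_def)
  next
    case False
    then have "V c = (\<lambda>_. 0)" by (auto simp: V_def)
    then show ?thesis by simp
  qed
  show ?thesis
  proof (rule borel_measurable_LIMSEQ_real)
    fix n
    have "(\<lambda>x. V (real_of_int \<lfloor>real (Suc n) * fst x\<rfloor> / real (Suc n)) x) \<in> borel_measurable (lborel \<Otimes>\<^sub>M M)"
      by (rule measurable_compose_countable[where
            f = "\<lambda>i x. V (real_of_int i / real (Suc n)) x" and g = "\<lambda>x. \<lfloor>real (Suc n) * fst x\<rfloor>"])
        (simp_all add: V)
    then show "(\<lambda>x. V (g n (fst x)) x) \<in> borel_measurable (lborel \<Otimes>\<^sub>M M)"
      by (simp add: g_def)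
  next
    fix x :: "real \<times> 'a" assume "x \<in> space (lborel \<Otimes>\<^sub>M M)"
    then obtain t \<omega> where x: "x = (t, \<omega>)" and \<omega>: "\<omega> \<in> space M"
      by (cases x) (auto simp: space_pair_measure)
    show "(\<lambda>n. V (g n (fst x)) x) \<longlonglongrightarrow> (case x of (t, \<omega>) \<Rightarrow> indicator {0<..<T} t * Y t \<omega>)"
    proof (cases "0 < t \<and> t < T")
      case True
      have "(\<lambda>n. Y (g n t) \<omega>) \<longlonglongrightarrow> Y t \<omega>"
        by (rule continuous_on_tendsto_compose[OF cont[OF \<omega>] g_lim])
          (use True g_ge g_le[THEN le_less_trans] in auto)
      moreover have "V (g n (fst x)) x = Y (g n t) \<omega>" for n
        using True g_ge g_le[THEN le_less_trans] by (auto simp: V_def x)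
      ultimately show ?thesis using True x by simp
    next
      case False
      then have outside: "indicator {0<..<T} t = (0::real)" by (auto split: split_indicator)
      then have "V c (t, \<omega>) = 0" for c by (simp only: V_def prod.case mult_zero_left if_cancel)
      then show ?thesis by (simp add: x outside)
    qed
  qed
qed

text \<open>
  Fubini's theorem for \<open>(Y t)\<^sup>2\<close>. Integrability on the product space comes from the integrability of
  the second moments in time, by nonnegativity of the integrand; in particular almost every path is
  square integrable on \<open>(0, T)\<close>, although the paths may be badly behaved near \<open>T\<close>.
\<close>

lemma (in prob_space) expectation_time_integral:
  fixes Y :: "real \<Rightarrow> 'a \<Rightarrow> real" and T :: real
  assumes "0 < T"
    and meas: "\<And>t. 0 \<le> t \<Longrightarrow> t < T \<Longrightarrow> Y t \<in> borel_measurable M"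
    and cont: "\<And>\<omega>. \<omega> \<in> space M \<Longrightarrow> continuous_on {0..<T} (\<lambda>t. Y t \<omega>)"
    and moment: "\<And>t. 0 < t \<Longrightarrow> t < T \<Longrightarrow> has_bochner_integral M (\<lambda>\<omega>. (Y t \<omega>)\<^sup>2) (h t)"
    and h: "has_bochner_integral lborel (\<lambda>t. h t * indicator {0<..<T} t) v"
  shows "expectation (\<lambda>\<omega>. LBINT t=0..T. (Y t \<omega>)\<^sup>2) = v"
proof -
  interpret pair_sigma_finite "lborel :: real measure" M
    by (intro pair_sigma_finite.intro sigma_finite_lborel sigma_finite_measure_axioms)
  define F where "F t \<omega> = indicator {0<..<T} t * (Y t \<omega>)\<^sup>2" for t \<omega>
  have "(\<lambda>x. (case x of (t, \<omega>) \<Rightarrow> indicator {0<..<T} t * Y t \<omega>)\<^sup>2) \<in> borel_measurable (lborel \<Otimes>\<^sub>M M)"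
    by (intro borel_measurable_power borel_measurable_continuous_paths meas cont)
  also have "(\<lambda>x. (case x of (t, \<omega>) \<Rightarrow> indicator {0<..<T} t * Y t \<omega>)\<^sup>2) = case_prod F"
    by (auto simp: F_def fun_eq_iff split: split_indicator)
  finally have F: "case_prod F \<in> borel_measurable (lborel \<Otimes>\<^sub>M M)" .
  have EF: "has_bochner_integral M (F t) (indicator {0<..<T} t * h t)" for t
    using moment[of t] unfolding F_def
    by (cases "t \<in> {0<..<T}") (auto simp: has_bochner_integral_zero)
  have EF': "expectation (F t) = indicator {0<..<T} t * h t" for t
    using EF has_bochner_integral_integral_eq by blast
  have "integrable (lborel \<Otimes>\<^sub>M M) (case_prod F)"
  proof (rule Fubini_integrable[OF F])
    have "(\<integral>\<omega>. norm (case_prod F (t, \<omega>)) \<partial>M) = indicator {0<..<T} t * h t" for t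
    proof -
      have "(\<integral>\<omega>. norm (case_prod F (t, \<omega>)) \<partial>M) = expectation (F t)"
        by (rule Bochner_Integration.integral_cong) (auto simp: F_def)
      then show ?thesis using EF' by simp
    qed
    then show "integrable lborel (\<lambda>t. \<integral>\<omega>. norm (case_prod F (t, \<omega>)) \<partial>M)"
      using h by (simp add: has_bochner_integral_iff mult.commute)
    show "AE t in lborel. integrable M (\<lambda>\<omega>. case_prod F (t, \<omega>))"
      using EF by (auto simp: has_bochner_integral_iff)
  qed
  from Fubini_integral[OF this]
  have "(\<integral>\<omega>. (\<integral>t. F t \<omega> \<partial>lborel) \<partial>M) = v"
    using h by (simp add: EF' has_bochner_integral_iff mult.commute)
  then show ?thesis
    using \<open>0 < T\<close> by (simp add: interval_integral_Ioo set_lebesgue_integral_def F_def)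
qed

section \<open>Hyperbolic integrals\<close>

lemma has_bochner_integral_FTC_Ioo:
  fixes f F :: "real \<Rightarrow> real"
  assumes "a \<le> b" "\<And>x. a \<le> x \<Longrightarrow> x \<le> b \<Longrightarrow> DERIV F x :> f x"
    "\<And>x. a \<le> x \<Longrightarrow> x \<le> b \<Longrightarrow> isCont f x"
  shows "has_bochner_integral lborel (\<lambda>x. f x * indicator {a<..<b} x) (F b - F a)"
proof -
  have "has_bochner_integral lborel (\<lambda>x. f x * indicator {a..b} x) (F b - F a)"
    by (rule has_bochner_integral_FTC_Icc_real[OF assms])
  then show ?thesis
    by (rule has_bochner_integral_discrete_difference[of "{a, b}", THEN iffD1, rotated -1])
      (auto split: split_indicator)
qed

lemma sinh_ratio_ge_1:
  fixes q t T :: real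
  assumes "q \<noteq> 0" "0 < t" "t \<le> T"
  shows "1 \<le> sinh (q * T) / sinh (q * t)"
proof (cases "0 < q")
  case True
  then have "0 < sinh (q * t)" "sinh (q * t) \<le> sinh (q * T)"
    using assms by simp_all
  then show ?thesis by simp
next
  case False
  then have "sinh (q * t) < 0" "sinh (q * T) \<le> sinh (q * t)"
    using assms by (simp_all add: mult_less_0_iff)
  then show ?thesis by (simp add: le_divide_eq)
qed

lemma coth_diff:
  fixes x y :: real
  assumes "x \<noteq> 0" "y \<noteq> 0"
  shows "cosh x / sinh x - cosh y / sinh y = sinh (y - x) / (sinh x * sinh y)"
  using assms by (simp add: sinh_diff divide_simps)

lemma sinh_mult_exp: "2 * sinh x * exp (- x) = 1 - exp (- 2 * x)" for x :: real
proof -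
  have "exp x * exp (- x) = 1" "exp (- x) * exp (- x) = exp (- 2 * x)"
    by (simp_all flip: exp_add)
  then show ?thesis by (simp add: sinh_field_def left_diff_distrib)
qed

context
  fixes q t T :: real
  assumes q: "q \<noteq> 0" and t: "0 \<le> t"
begin

lemma integral_exp_sq:
  "has_bochner_integral lborel (\<lambda>s. (exp (q * (t - s)))\<^sup>2 * indicator {0..t} s)
    ((exp (2 * q * t) - 1) / (2 * q))"
proof -
  have "has_bochner_integral lborel (\<lambda>s. (exp (q * (t - s)))\<^sup>2 * indicator {0..t} s)
      (- (exp (q * (t - t)))\<^sup>2 / (2 * q) - - (exp (q * (t - 0)))\<^sup>2 / (2 * q))"
    using q t
    by (intro has_bochner_integral_FTC_Icc_real)
      (auto intro!: derivative_eq_intros continuous_intros simp: power2_eq_square)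
  then show ?thesis by (simp add: diff_divide_distrib exp_double[symmetric] mult.assoc)
qed

lemma integral_exp:
  "has_bochner_integral lborel (\<lambda>s. exp (q * (t - s)) * indicator {0..t} s)
    ((exp (q * t) - 1) / q)"
proof -
  have "has_bochner_integral lborel (\<lambda>s. exp (q * (t - s)) * indicator {0..t} s)
      (- exp (q * (t - t)) / q - - exp (q * (t - 0)) / q)"
    using q t
    by (intro has_bochner_integral_FTC_Icc_real)
      (auto intro!: derivative_eq_intros continuous_intros)
  then show ?thesis by (simp add: diff_divide_distrib)
qed

text \<open>
  The variance of the integral representation, without the factor \<open>\<sigma>\<^sup>2\<close>. The antiderivative of
  \<open>1 / sinh\<^sup>2 (q (T - s))\<close> is \<open>coth (q (T - s)) / q\<close>.
\<close>

lemma integral_sinh_kernel_sq: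
  assumes "t < T"
  shows "has_bochner_integral lborel
    (\<lambda>s. (sinh (q * (T - t)) / sinh (q * (T - s)))\<^sup>2 * indicator {0..t} s)
    (sinh (q * (T - t)) * sinh (q * t) / (q * sinh (q * T)))"
proof -
  have nz: "sinh (q * (T - s)) \<noteq> 0" if "s \<le> t" for s using that assms q by simp
  define F where "F s = (sinh (q * (T - t)))\<^sup>2 / q * (cosh (q * (T - s)) / sinh (q * (T - s)))" for s
  have "has_bochner_integral lborel
      (\<lambda>s. (sinh (q * (T - t)) / sinh (q * (T - s)))\<^sup>2 * indicator {0..t} s) (F t - F 0)"
  proof (rule has_bochner_integral_FTC_Icc_real[OF t])
    fix s assume s: "0 \<le> s" "s \<le> t"
    have "DERIV F s :> (sinh (q * (T - t)))\<^sup>2 / q *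
        ((sinh (q * (T - s)) * (- q) * sinh (q * (T - s)) - cosh (q * (T - s)) * (cosh (q * (T - s)) * (- q)))
          / (sinh (q * (T - s)) * sinh (q * (T - s))))"
      unfolding F_def using nz[OF s(2)] by (intro DERIV_cmult DERIV_divide) (auto intro!: derivative_eq_intros)
    also have "(sinh (q * (T - s)) * (- q) * sinh (q * (T - s)) - cosh (q * (T - s)) * (cosh (q * (T - s)) * (- q)))
        = q * ((cosh (q * (T - s)))\<^sup>2 - (sinh (q * (T - s)))\<^sup>2)"
      by (simp add: power2_eq_square algebra_simps)
    also have "(cosh (q * (T - s)))\<^sup>2 - (sinh (q * (T - s)))\<^sup>2 = 1"
      by (rule hyperbolic_pythagoras)
    finally show "DERIV F s :> (sinh (q * (T - t)) / sinh (q * (T - s)))\<^sup>2"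
      using q by (simp add: power2_eq_square)
    show "isCont (\<lambda>s. (sinh (q * (T - t)) / sinh (q * (T - s)))\<^sup>2) s"
      using nz[OF s(2)] by (intro continuous_intros) auto
  qed
  also have "F t - F 0 = (sinh (q * (T - t)))\<^sup>2 / q *
      (cosh (q * (T - t)) / sinh (q * (T - t)) - cosh (q * T) / sinh (q * T))"
    by (simp add: F_def right_diff_distrib)
  also have "\<dots> = (sinh (q * (T - t)))\<^sup>2 / q * (sinh (q * t) / (sinh (q * (T - t)) * sinh (q * T)))"
    using q t assms by (subst coth_diff) (auto simp: algebra_simps)
  also have "\<dots> = sinh (q * (T - t)) * sinh (q * t) / (q * sinh (q * T))"
    using nz[of t] by (simp add: power2_eq_square)
  finally show ?thesis .
qed

text \<open>
  The covariance between the process and the integral representation, without the factor \<open>\<sigma>\<^sup>2\<close>.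
  Writing \<open>exp (q (t - s)) = exp (- q (T - t)) exp (q (T - s))\<close> turns the integrand into a constant times
  \<open>1 + coth (q (T - s))\<close>, whose antiderivative contains the logarithm of \<open>sinh\<close>. The ratio to
  \<open>sinh (q T)\<close> keeps the argument of the logarithm positive for both signs of \<open>q\<close>.
\<close>

lemma integral_exp_sinh_kernel:
  assumes "t < T"
  shows "has_bochner_integral lborel
    (\<lambda>s. exp (q * (t - s)) * (sinh (q * (T - t)) / sinh (q * (T - s))) * indicator {0..t} s)
    ((1 - exp (- 2 * (q * (T - t)))) / 2 * (t + ln (sinh (q * T) / sinh (q * (T - t))) / q))"
proof -
  define K where "K = sinh (q * (T - t)) * exp (- (q * (T - t)))"
  define F where "F s = K * (s + ln (sinh (q * T) / sinh (q * (T - s))) / q)" for s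
  have nz: "sinh (q * (T - s)) \<noteq> 0" if "s \<le> t" for s using that assms q by simp
  have "has_bochner_integral lborel
      (\<lambda>s. exp (q * (t - s)) * (sinh (q * (T - t)) / sinh (q * (T - s))) * indicator {0..t} s) (F t - F 0)"
  proof (rule has_bochner_integral_FTC_Icc_real[OF t])
    fix s assume s: "0 \<le> s" "s \<le> t"
    let ?S = "sinh (q * (T - s))" and ?C = "cosh (q * (T - s))"
    have pos: "0 < sinh (q * T) / ?S"
      using sinh_ratio_ge_1[of q "T - s" T] s assms q by simp
    have S: "?S \<noteq> 0" and X: "sinh (q * T) \<noteq> 0" using nz s q assms by auto
    have "DERIV (\<lambda>s. sinh (q * T) / sinh (q * (T - s))) s :> sinh (q * T) * ?C * q / (?S * ?S)"
      using S by (auto intro!: derivative_eq_intros)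
    then have "DERIV (\<lambda>s. ln (sinh (q * T) / sinh (q * (T - s)))) s :>
        1 / (sinh (q * T) / ?S) * (sinh (q * T) * ?C * q / (?S * ?S))"
      by (intro DERIV_chain2[where f = ln and
          g = "\<lambda>s. sinh (q * T) / sinh (q * (T - s))", OF DERIV_ln_divide[OF pos]])
    also have "1 / (sinh (q * T) / ?S) * (sinh (q * T) * ?C * q / (?S * ?S)) = q * (?C / ?S)"
      using S X by simp
    finally have D: "DERIV (\<lambda>s. ln (sinh (q * T) / sinh (q * (T - s)))) s :> q * (?C / ?S)" .
    have "DERIV F s :> K * (1 + q * (?C / ?S) / q)"
      unfolding F_def by (intro DERIV_cmult DERIV_add DERIV_ident DERIV_cdivide D)
    also have "K * (1 + q * (?C / ?S) / q) =
        sinh (q * (T - t)) * (exp (- (q * (T - t))) * (?S + ?C)) / ?S"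
      using S q by (simp add: K_def field_simps)
    also have "exp (- (q * (T - t))) * (?S + ?C) = exp (q * (t - s))"
      unfolding sinh_plus_cosh exp_add[symmetric] by (simp add: algebra_simps)
    finally show "DERIV F s :> exp (q * (t - s)) * (sinh (q * (T - t)) / ?S)"
      by (simp add: mult.commute)
    show "isCont (\<lambda>s. exp (q * (t - s)) * (sinh (q * (T - t)) / sinh (q * (T - s)))) s"
      using S by (intro continuous_intros) auto
  qed
  also have "F t - F 0 = K * (t + ln (sinh (q * T) / sinh (q * (T - t))) / q)"
    using q assms t by (simp add: F_def)
  also have "K = (1 - exp (- 2 * (q * (T - t)))) / 2"
    using sinh_mult_exp[of "q * (T - t)"] by (simp add: K_def)
  finally show ?thesis .
qed

end

context
  fixes q T :: real
  assumes q: "q \<noteq> 0" and T: "0 < T"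
begin

text \<open>
  The time integrals of the ingredients of the second moments. In the antiderivatives, coefficients
  are abbreviated by \<open>c\<close> and \<open>d\<close>, so that differentiation treats them as constants.
\<close>

lemma time_integral_mean_sq:
  "has_bochner_integral lborel (\<lambda>t. (sinh (q * t) / sinh (q * T))\<^sup>2 * indicator {0<..<T} t)
    (1 / (4 * q) * ((sinh (2 * q * T) - 2 * q * T) / (sinh (q * T))\<^sup>2))"
proof -
  define c where "c = 1 / (4 * q * (sinh (q * T))\<^sup>2)"
  define F where "F t = c * (sinh (2 * q * t) - 2 * q * t)" for t
  have X: "sinh (q * T) \<noteq> 0" using q T by simp
  have "has_bochner_integral lborel (\<lambda>t. (sinh (q * t) / sinh (q * T))\<^sup>2 * indicator {0<..<T} t)
      (F T - F 0)"
  proof (rule has_bochner_integral_FTC_Ioo)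
    fix t
    have "DERIV F t :> c * (cosh (2 * q * t) * (2 * q) - 2 * q)"
      unfolding F_def by (auto intro!: derivative_eq_intros)
    also have "cosh (2 * q * t) * (2 * q) - 2 * q = 4 * q * (sinh (q * t))\<^sup>2"
      using cosh_double[of "q * t"] cosh_square_eq[of "q * t"] by (simp add: algebra_simps)
    finally show "DERIV F t :> (sinh (q * t) / sinh (q * T))\<^sup>2"
      using q by (simp add: c_def power_divide)
  qed (use T X in \<open>auto intro!: continuous_intros\<close>)
  then show ?thesis by (simp add: F_def c_def)
qed

lemma time_integral_OU_variance:
  "has_bochner_integral lborel (\<lambda>t. (exp (2 * q * t) - 1) / (2 * q) * indicator {0<..<T} t)
    ((exp (2 * q * T) - 1) / (4 * q\<^sup>2) - T / (2 * q))"
proof -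
  define c where "c = 1 / (2 * q)"
  define F where "F t = c * (c * exp (2 * q * t) - t)" for t
  have "has_bochner_integral lborel (\<lambda>t. (exp (2 * q * t) - 1) / (2 * q) * indicator {0<..<T} t)
      (F T - F 0)"
  proof (rule has_bochner_integral_FTC_Ioo)
    fix t
    have "DERIV F t :> c * (c * (exp (2 * q * t) * (2 * q)) - 1)"
      unfolding F_def by (auto intro!: derivative_eq_intros)
    also have "c * (c * (exp (2 * q * t) * (2 * q)) - 1) = (exp (2 * q * t) - 1) / (2 * q)"
      using q by (simp add: c_def)
    finally show "DERIV F t :> (exp (2 * q * t) - 1) / (2 * q)" .
  qed (use T q in \<open>auto intro!: continuous_intros\<close>)
  moreover have "F T - F 0 = (exp (2 * q * T) - 1) / (4 * q\<^sup>2) - T / (2 * q)"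
    using q by (simp add: F_def c_def field_simps power2_eq_square)
  ultimately show ?thesis by simp
qed

lemma time_integral_bridge_variance:
  "has_bochner_integral lborel
    (\<lambda>t. sinh (q * (T - t)) * sinh (q * t) / (q * sinh (q * T)) * indicator {0<..<T} t)
    (T * cosh (q * T) / (2 * q * sinh (q * T)) - 1 / (2 * q\<^sup>2))"
proof -
  define c d where "c = 1 / (2 * q * sinh (q * T))" and "d = 1 / (2 * q)"
  define F where "F t = c * (t * cosh (q * T) - d * sinh (q * (2 * t - T)))" for t
  have X: "sinh (q * T) \<noteq> 0" using q T by simp
  have "has_bochner_integral lborel
      (\<lambda>t. sinh (q * (T - t)) * sinh (q * t) / (q * sinh (q * T)) * indicator {0<..<T} t) (F T - F 0)"
  proof (rule has_bochner_integral_FTC_Ioo)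
    fix t
    have "DERIV F t :> c * (cosh (q * T) - d * (cosh (q * (2 * t - T)) * (q * 2)))"
      unfolding F_def by (auto intro!: derivative_eq_intros)
    also have "cosh (q * T) - d * (cosh (q * (2 * t - T)) * (q * 2)) =
        2 * (sinh (q * (T - t)) * sinh (q * t))"
      unfolding d_def using q cosh_add[of "q * (T - t)" "q * t"] cosh_diff[of "q * t" "q * (T - t)"]
      by (simp add: algebra_simps)
    finally show "DERIV F t :> sinh (q * (T - t)) * sinh (q * t) / (q * sinh (q * T))"
      by (simp add: c_def)
  qed (use T X q in \<open>auto intro!: continuous_intros\<close>)
  also have "F T - F 0 = T * cosh (q * T) / (2 * q * sinh (q * T)) - 1 / (2 * q\<^sup>2)"
    using X q by (simp add: F_def c_def d_def field_simps power2_eq_square)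
  finally show ?thesis .
qed

lemma time_integral_exp_linear:
  "has_bochner_integral lborel
    (\<lambda>t. (1 - exp (- 2 * (q * (T - t)))) / 2 * t * indicator {0<..<T} t)
    (T\<^sup>2 / 4 - T / (4 * q) + (1 - exp (- 2 * q * T)) / (8 * q\<^sup>2))"
proof -
  define c where "c = 1 / (2 * q)"
  define F where "F t = (t\<^sup>2 / 2 - c * exp (- 2 * (q * (T - t))) * (t - c)) / 2" for t
  have "has_bochner_integral lborel
      (\<lambda>t. (1 - exp (- 2 * (q * (T - t)))) / 2 * t * indicator {0<..<T} t) (F T - F 0)"
  proof (rule has_bochner_integral_FTC_Ioo)
    fix t
    have "DERIV F t :> (t - (c * (exp (- 2 * (q * (T - t))) * (2 * q)) * (t - c)
        + c * exp (- 2 * (q * (T - t))))) / 2"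
      unfolding F_def by (auto intro!: derivative_eq_intros)
    also have "(t - (c * (exp (- 2 * (q * (T - t))) * (2 * q)) * (t - c)
        + c * exp (- 2 * (q * (T - t))))) / 2 = (1 - exp (- 2 * (q * (T - t)))) / 2 * t"
      using q by (simp add: c_def field_simps)
    finally show "DERIV F t :> (1 - exp (- 2 * (q * (T - t)))) / 2 * t" .
  qed (use T q in \<open>auto intro!: continuous_intros\<close>)
  also have "F T - F 0 = T\<^sup>2 / 4 - T / (4 * q) + (1 - exp (- 2 * q * T)) / (8 * q\<^sup>2)"
    using q by (simp add: F_def c_def field_simps power2_eq_square)
  finally show ?thesis .
qed

lemma time_integral_st_covariance:
  "has_bochner_integral lborel
    (\<lambda>t. sinh (q * (T - t)) / sinh (q * T) * ((exp (q * t) - 1) / q) * indicator {0<..<T} t)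
    (T * exp (q * T) / (2 * q * sinh (q * T)) - 1 / (2 * q\<^sup>2) - (cosh (q * T) - 1) / (q\<^sup>2 * sinh (q * T)))"
proof -
  define c d where "c = 1 / (q * sinh (q * T))" and "d = 1 / q"
  define F where "F t = c * (t * exp (q * T) / 2 - d * exp (q * (2 * t - T)) / 4 + d * cosh (q * (T - t)))" for t
  have X: "sinh (q * T) \<noteq> 0" using q T by simp
  have "has_bochner_integral lborel
      (\<lambda>t. sinh (q * (T - t)) / sinh (q * T) * ((exp (q * t) - 1) / q) * indicator {0<..<T} t) (F T - F 0)"
  proof (rule has_bochner_integral_FTC_Ioo)
    fix t
    have "DERIV F t :> c * (exp (q * T) / 2 - d * (exp (q * (2 * t - T)) * (q * 2)) / 4
        + d * (sinh (q * (T - t)) * (- q)))"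
      unfolding F_def by (auto intro!: derivative_eq_intros)
    also have "exp (q * T) / 2 - d * (exp (q * (2 * t - T)) * (q * 2)) / 4 + d * (sinh (q * (T - t)) * (- q))
        = sinh (q * (T - t)) * (exp (q * t) - 1)"
    proof -
      define u where "u = q * (T - t)"
      have "exp (q * T) = exp u * exp (q * t)" "exp (q * (2 * t - T)) = exp (- u) * exp (q * t)"
        unfolding exp_add[symmetric] u_def by (simp_all add: algebra_simps)
      then show ?thesis
        using q unfolding u_def[symmetric] by (simp add: d_def sinh_field_def field_simps)
    qed
    finally show "DERIV F t :> sinh (q * (T - t)) / sinh (q * T) * ((exp (q * t) - 1) / q)"
      by (simp add: c_def mult.commute)
  qed (use T X q in \<open>auto intro!: continuous_intros\<close>)
  also have "F T - F 0 = c * (T * exp (q * T) / 2 - d * (exp (q * T) - exp (- (q * T))) / 4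
      - d * (cosh (q * T) - 1))"
    by (simp add: F_def field_simps)
  also have "exp (q * T) - exp (- (q * T)) = 2 * sinh (q * T)"
    by (simp add: sinh_field_def)
  also have "c * (T * exp (q * T) / 2 - d * (2 * sinh (q * T)) / 4 - d * (cosh (q * T) - 1))
      = T * exp (q * T) / (2 * q * sinh (q * T)) - 1 / (2 * q\<^sup>2) - (cosh (q * T) - 1) / (q\<^sup>2 * sinh (q * T))"
    using X q by (simp add: c_def d_def field_simps power2_eq_square)
  finally show ?thesis .
qed

text \<open>
  The substitution \<open>x = q (T - t)\<close>. For negative \<open>q\<close>, the sign of the oriented integral makes up for
  the absolute value in the change of variables.
\<close>

lemma LBINT_time_reversal:
  "(LBINT x=0..q * T. g x) = q * (\<integral>t. g (q * (T - t)) * indicator {0<..<T} t \<partial>lborel)"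
proof (cases "0 < q")
  case True
  have "(\<integral>x. indicator {0<..<q * T} x *\<^sub>R g x \<partial>lborel) =
      \<bar>- q\<bar> *\<^sub>R (\<integral>t. indicator {0<..<q * T} (q * T + - q * t) *\<^sub>R g (q * T + - q * t) \<partial>lborel)"
    using q by (intro lborel_integral_real_affine) simp
  also have "(\<lambda>t. indicator {0<..<q * T} (q * T + - q * t) *\<^sub>R g (q * T + - q * t)) =
      (\<lambda>t. g (q * (T - t)) * indicator {0<..<T} t)"
  proof
    fix t
    have "q * T + - q * t = q * (T - t)" "0 < q * (T - t) \<longleftrightarrow> t < T" "q * (T - t) < q * T \<longleftrightarrow> 0 < t"
      using True by (simp_all add: right_diff_distrib zero_less_mult_iff)
    then show "indicator {0<..<q * T} (q * T + - q * t) *\<^sub>R g (q * T + - q * t) =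
        g (q * (T - t)) * indicator {0<..<T} t"
      by (auto simp: indicator_def)
  qed
  finally show ?thesis
    using True T interval_integral_Ioo[of 0 "ereal (q * T)" g]
    by (simp add: set_lebesgue_integral_def zero_ereal_def)
next
  case False
  then have neg: "q < 0" using q by simp
  then have qT: "q * T < 0" using T by (simp add: mult_less_0_iff)
  have "(\<integral>x. indicator {q * T<..<0} x *\<^sub>R g x \<partial>lborel) =
      \<bar>- q\<bar> *\<^sub>R (\<integral>t. indicator {q * T<..<0} (q * T + - q * t) *\<^sub>R g (q * T + - q * t) \<partial>lborel)"
    using q by (intro lborel_integral_real_affine) simp
  also have "(\<lambda>t. indicator {q * T<..<0} (q * T + - q * t) *\<^sub>R g (q * T + - q * t)) =
      (\<lambda>t. g (q * (T - t)) * indicator {0<..<T} t)"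
  proof
    fix t
    have "q * T + - q * t = q * (T - t)" "q * (T - t) < 0 \<longleftrightarrow> t < T" "q * T < q * (T - t) \<longleftrightarrow> 0 < t"
      using neg by (simp_all add: right_diff_distrib mult_less_0_iff)
    then show "indicator {q * T<..<0} (q * T + - q * t) *\<^sub>R g (q * T + - q * t) =
        g (q * (T - t)) * indicator {0<..<T} t"
      by (auto simp: indicator_def)
  qed
  finally show ?thesis
    using neg qT interval_integral_Ioo[of "ereal (q * T)" 0 g]
    by (subst interval_integral_endpoints_reverse) (simp add: set_lebesgue_integral_def zero_ereal_def)
qed

text \<open>
  The singularity of the logarithm at \<open>t = T\<close> is compensated by the factor in front of it: with
  \<open>x = q (T - t)\<close> and \<open>y = sinh (q T) / sinh x\<close>, this factor is \<open>2 sinh x exp (- x)\<close> and \<open>ln y \<le> y\<close>,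
  so that \<open>sinh x\<close> cancels and the integrand is bounded.
\<close>

lemma time_integral_log:
  "has_bochner_integral lborel
    (\<lambda>t. (1 - exp (- 2 * (q * (T - t)))) * ln (sinh (q * T) / sinh (q * (T - t))) * indicator {0<..<T} t)
    ((LBINT x=0..q * T. (1 - exp (- 2 * x)) * ln (sinh (q * T) / sinh x)) / q)"
proof -
  define G where "G x = (1 - exp (- 2 * x)) * ln (sinh (q * T) / sinh x)" for x
  define B where "B = 2 * exp \<bar>q * T\<bar> * \<bar>sinh (q * T)\<bar>"
  have X: "sinh (q * T) \<noteq> 0" using q T by simp
  have bound: "\<bar>G (q * (T - t))\<bar> \<le> B" if t: "0 < t" "t < T" for t
  proof -
    define x where "x = q * (T - t)"
    define y where "y = sinh (q * T) / sinh x"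
    have y: "1 \<le> y" using sinh_ratio_ge_1[of q "T - t" T] q t by (simp add: x_def y_def)
    have "0 \<le> ln y" "ln y \<le> y" using y ln_le_minus_one[of y] by (simp_all add: ln_ge_zero)
    have x0: "sinh x \<noteq> 0" using q t by (simp add: x_def)
    have "\<bar>G x\<bar> = \<bar>2 * sinh x * exp (- x)\<bar> * ln y"
      unfolding sinh_mult_exp using \<open>0 \<le> ln y\<close> by (simp add: G_def y_def abs_mult)
    also have "\<dots> \<le> \<bar>2 * sinh x * exp (- x)\<bar> * \<bar>y\<bar>"
      using \<open>ln y \<le> y\<close> by (intro mult_left_mono) auto
    also have "\<dots> = 2 * exp (- x) * \<bar>sinh (q * T)\<bar>"
      using x0 by (simp add: y_def abs_mult abs_divide)
    also have "\<dots> \<le> B"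
    proof -
      have "\<bar>x\<bar> \<le> \<bar>q * T\<bar>" using t q by (simp add: x_def abs_mult mult_left_mono)
      then have "exp (- x) \<le> exp \<bar>q * T\<bar>" by simp
      then show ?thesis unfolding B_def by (intro mult_right_mono) auto
    qed
    finally show ?thesis by (simp add: x_def)
  qed
  have "continuous_on {0<..<T} (\<lambda>t. G (q * (T - t)))"
    unfolding G_def using X q by (intro continuous_intros) auto
  then have meas: "(\<lambda>t. indicator {0<..<T} t *\<^sub>R G (q * (T - t))) \<in> borel_measurable borel"
    by (intro borel_measurable_continuous_on_indicator) auto
  have "integrable lborel (\<lambda>t. indicator {0<..<T} t *\<^sub>R G (q * (T - t)))"
  proof (rule Bochner_Integration.integrable_bound)
    show "integrable lborel (\<lambda>t. B * indicator {0<..<T} t)"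
      using T by (intro integrable_mult_right integrable_real_indicator) auto
    show "AE t in lborel. norm (indicator {0<..<T} t *\<^sub>R G (q * (T - t))) \<le> norm (B * indicator {0<..<T} t)"
      using order_trans[OF bound abs_ge_self] by (intro AE_I2) (auto split: split_indicator)
  qed (use meas in simp)
  then have "has_bochner_integral lborel (\<lambda>t. G (q * (T - t)) * indicator {0<..<T} t)
      ((LBINT x=0..q * T. G x) / q)"
    using q LBINT_time_reversal[of G] by (simp add: has_bochner_integral_iff mult.commute)
  then show ?thesis by (simp add: G_def)
qed

end

section \<open>The clock of the space-time transform\<close>

lemma OU_kappa_sinh:
  assumes "q \<noteq> 0"
  shows "OU_kappa q t = exp (- (q * t)) * sinh (q * t) / q"
proof -
  have "OU_kappa q t = 2 * sinh (q * t) * exp (- (q * t)) / (2 * q)"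
    unfolding sinh_mult_exp by (simp add: OU_kappa_def mult.assoc)
  then show ?thesis by simp
qed

lemma OU_kappa_diff:
  assumes "q \<noteq> 0"
  shows "OU_kappa q T - OU_kappa q t = exp (- (q * t)) * exp (- (q * T)) * sinh (q * (T - t)) / q"
proof -
  have "exp (- (q * t)) * exp (- (q * T)) * (exp (q * (T - t)) - exp (- (q * (T - t)))) =
      exp (- 2 * q * t) - exp (- 2 * q * T)"
    unfolding right_diff_distrib exp_add[symmetric] by (simp add: algebra_simps)
  then show ?thesis
    using assms by (simp add: OU_kappa_def sinh_field_def diff_divide_distrib[symmetric])
qed

text \<open>
  In hyperbolic form, the time change and the amplitude of the space-time transform no longer
  contain \<open>OU_kappa\<close>, and their sign and size can be read off.
\<close>

lemma space_time_clock:
  assumes "q \<noteq> 0" "0 \<le> t" "t < T"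
  shows "OU_kappa q t * OU_kappa q T / (OU_kappa q T - OU_kappa q t) =
    sinh (q * t) * sinh (q * T) / (q * sinh (q * (T - t)))"
  unfolding OU_kappa_diff[OF assms(1)]
  unfolding OU_kappa_sinh[OF assms(1)]
  using assms by simp

lemma space_time_factor:
  assumes "q \<noteq> 0" "0 \<le> t" "t < T"
  shows "exp (q * t) * ((OU_kappa q T - OU_kappa q t) / OU_kappa q T) = sinh (q * (T - t)) / sinh (q * T)"
proof -
  have "exp (q * t) * exp (- (q * t)) = 1" by (simp flip: exp_add)
  then show ?thesis
    unfolding OU_kappa_diff[OF assms(1)]
    unfolding OU_kappa_sinh[OF assms(1)]
    using assms by (simp add: mult.assoc[symmetric])
qed

lemma sinh_ge_self: "x \<le> sinh x" if "0 \<le> x" for x :: real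
  using real_le_x_sinh[OF that] by (simp add: sinh_field_def exp_minus)

text \<open>
  The space-time transform evaluates \<open>W\<close> no earlier than at the current time. Hence its covariance
  with the process at time \<open>t\<close> involves all of \<open>[0, t]\<close>. The two factors of the bound are
  \<open>sinh (q t) / q \<ge> t\<close> and \<open>sinh (q T) / sinh (q (T - t)) \<ge> 1\<close>.
\<close>

lemma time_le_space_time_clock:
  fixes q t T :: real
  assumes "q \<noteq> 0" "0 \<le> t" "t < T"
  shows "t \<le> sinh (q * t) * sinh (q * T) / (q * sinh (q * (T - t)))"
proof -
  have "\<bar>q * t\<bar> \<le> \<bar>sinh (q * t)\<bar>"
    using sinh_ge_self[of "\<bar>q * t\<bar>"] by simp
  then have "t \<le> sinh (q * t) / q"
  proof (cases "0 < q")
    case False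
    then have "q < 0" using assms by simp
    moreover from this have "q * t \<le> 0" using assms(2) by (simp add: mult_le_0_iff)
    ultimately show ?thesis
      using \<open>\<bar>q * t\<bar> \<le> \<bar>sinh (q * t)\<bar>\<close> by (simp add: neg_le_divide_eq mult.commute abs_of_nonpos)
  qed (use assms in \<open>simp add: pos_le_divide_eq mult.commute\<close>)
  also have "\<dots> * 1 \<le> sinh (q * t) / q * (sinh (q * T) / sinh (q * (T - t)))"
  proof (rule mult_left_mono)
    show "1 \<le> sinh (q * T) / sinh (q * (T - t))"
      using sinh_ratio_ge_1[of q "T - t" T] assms by simp
    show "0 \<le> sinh (q * t) / q" using calculation assms by linarith
  qed
  finally show ?thesis by simp
qed

section \<open>The distances between process and bridges\<close>

lemma has_bochner_integral_Ioo_add: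
  fixes f g :: "real \<Rightarrow> real"
  assumes "has_bochner_integral lborel (\<lambda>t. f t * indicator {0<..<T} t) a"
    "has_bochner_integral lborel (\<lambda>t. g t * indicator {0<..<T} t) b"
  shows "has_bochner_integral lborel (\<lambda>t. (f t + g t) * indicator {0<..<T} t) (a + b)"
  using has_bochner_integral_add[OF assms] by (simp add: distrib_right)

lemma has_bochner_integral_Ioo_cmult:
  fixes f :: "real \<Rightarrow> real"
  assumes "has_bochner_integral lborel (\<lambda>t. f t * indicator {0<..<T} t) a"
  shows "has_bochner_integral lborel (\<lambda>t. (c * f t) * indicator {0<..<T} t) (c * a)"
  using has_bochner_integral_mult_right[OF assms, of c] by (simp add: mult.assoc)

lemma OU_process_integral:
  assumes "OU_process M W q \<sigma> U" "0 \<le> t"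
  obtains I where "has_wiener_integral M W (\<lambda>s. exp (q * (t - s))) 0 t I"
    "\<And>\<omega>. \<omega> \<in> space M \<Longrightarrow> U t \<omega> = \<sigma> * I \<omega>"
proof -
  from assms have "\<exists>I. has_wiener_integral M W (\<lambda>s. exp (q * (t - s))) 0 t I \<and>
      (\<forall>\<omega>\<in>space M. U t \<omega> = \<sigma> * I \<omega>)"
    unfolding OU_process_def by simp
  with that show thesis by blast
qed

lemma has_wiener_integral_measurable:
  "has_wiener_integral M W f a b X \<Longrightarrow> X \<in> borel_measurable M"
  by (simp add: has_wiener_integral_def)

lemma OU_process_measurable:
  assumes "OU_process M W q \<sigma> U" "0 \<le> t"
  shows "U t \<in> borel_measurable M"
proof -
  obtain I where I: "has_wiener_integral M W (\<lambda>s. exp (q * (t - s))) 0 t I"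
    "\<And>\<omega>. \<omega> \<in> space M \<Longrightarrow> U t \<omega> = \<sigma> * I \<omega>"
    by (rule OU_process_integral[OF assms]) blast
  show ?thesis
    using has_wiener_integral_measurable[OF I(1)] I(2)
    by (subst measurable_cong[where g="\<lambda>\<omega>. \<sigma> * I \<omega>"]) auto
qed

context wiener_process
begin

context
  fixes q \<sigma> b T :: real and U :: "real \<Rightarrow> 'a \<Rightarrow> real"
  assumes q: "q \<noteq> 0" and T: "0 < T" and U: "OU_process M W q \<sigma> U"
begin

text \<open>
  Here the difference is \<open>U T - b\<close> times a deterministic function of \<open>t\<close>, so that a single second
  moment is needed.
\<close>

lemma distance_av:
  "expectation (\<lambda>\<omega>. LBINT t=0..T. (U t \<omega> - OU_bridge_av q b T U t \<omega>)\<^sup>2) =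
    b\<^sup>2 / (4 * q) * ((sinh (2 * q * T) - 2 * q * T) / (sinh (q * T))\<^sup>2)
    + \<sigma>\<^sup>2 * exp (q * T) / (4 * q\<^sup>2) * ((sinh (2 * q * T) - 2 * q * T) / sinh (q * T))"
proof -
  let ?m = "\<lambda>t. sinh (q * t) / sinh (q * T)"
  let ?E = "b\<^sup>2 + \<sigma>\<^sup>2 * ((exp (2 * q * T) - 1) / (2 * q))"
  obtain I where I: "has_wiener_integral M W (\<lambda>s. exp (q * (T - s))) 0 T I"
    and UI: "\<And>\<omega>. \<omega> \<in> space M \<Longrightarrow> U T \<omega> = \<sigma> * I \<omega>"
    by (rule OU_process_integral[OF U less_imp_le[OF T]]) blast
  have X: "sinh (q * T) \<noteq> 0" using q T by simp
  have eq: "U t \<omega> - OU_bridge_av q b T U t \<omega> = ?m t * (U T \<omega> - b)" for t \<omega>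
    by (simp add: OU_bridge_av_def algebra_simps diff_divide_distrib)
  have "has_bochner_integral lborel (\<lambda>t. (?E * (?m t)\<^sup>2) * indicator {0<..<T} t)
      (?E * (1 / (4 * q) * ((sinh (2 * q * T) - 2 * q * T) / (sinh (q * T))\<^sup>2)))"
    by (intro has_bochner_integral_Ioo_cmult time_integral_mean_sq q T)
  then have "expectation (\<lambda>\<omega>. LBINT t=0..T. (U t \<omega> - OU_bridge_av q b T U t \<omega>)\<^sup>2) =
      ?E * (1 / (4 * q) * ((sinh (2 * q * T) - 2 * q * T) / (sinh (q * T))\<^sup>2))"
    unfolding eq
  proof (rule expectation_time_integral[OF T, rotated -1])
    fix t assume "0 < t" "t < T"
    have "has_bochner_integral M (\<lambda>\<omega>. (\<sigma> * ?m t * I \<omega> + 0 * I \<omega> + (- b * ?m t))\<^sup>2)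
        ((\<sigma> * ?m t)\<^sup>2 * ((exp (2 * q * T) - 1) / (2 * q)) + 2 * (\<sigma> * ?m t) * 0 * ((exp (2 * q * T) - 1) / (2 * q))
          + 0\<^sup>2 * ((exp (2 * q * T) - 1) / (2 * q)) + (- b * ?m t)\<^sup>2)"
      using integral_exp_sq[OF q, of T] T
      by (intro wiener_integrals_second_moment[OF I I]) (auto simp: power2_eq_square)
    moreover have "(\<sigma> * m)\<^sup>2 * e + 2 * (\<sigma> * m) * 0 * e + 0\<^sup>2 * e + (- b * m)\<^sup>2 = (b\<^sup>2 + \<sigma>\<^sup>2 * e) * m\<^sup>2"
      for m e :: real by (simp add: power2_eq_square algebra_simps)
    ultimately have "has_bochner_integral M (\<lambda>\<omega>. (\<sigma> * ?m t * I \<omega> + 0 * I \<omega> + (- b * ?m t))\<^sup>2) (?E * (?m t)\<^sup>2)"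
      by (simp only:)
    moreover have "(?m t * (U T \<omega> - b))\<^sup>2 = (\<sigma> * ?m t * I \<omega> + 0 * I \<omega> + (- b * ?m t))\<^sup>2"
      if "\<omega> \<in> space M" for \<omega>
      using UI[OF that] by (simp add: right_diff_distrib diff_divide_distrib mult_ac)
    ultimately show "has_bochner_integral M (\<lambda>\<omega>. (?m t * (U T \<omega> - b))\<^sup>2) (?E * (?m t)\<^sup>2)"
      by (subst has_bochner_integral_cong[OF refl _ refl]) auto
  next
    show "(\<lambda>\<omega>. ?m t * (U T \<omega> - b)) \<in> borel_measurable M" for t
      using OU_process_measurable[OF U, of T] T by simp
    show "continuous_on {0..<T} (\<lambda>t. ?m t * (U T \<omega> - b))" for \<omega>
      using X by (intro continuous_intros) auto
  qed
  also have "exp (2 * q * T) - 1 = 2 * exp (q * T) * sinh (q * T)"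
    using sinh_mult_exp[of "- (q * T)"] by (simp add: mult_ac)
  also have "(b\<^sup>2 + \<sigma>\<^sup>2 * (2 * exp (q * T) * sinh (q * T) / (2 * q))) *
      (1 / (4 * q) * ((sinh (2 * q * T) - 2 * q * T) / (sinh (q * T))\<^sup>2)) =
    b\<^sup>2 / (4 * q) * ((sinh (2 * q * T) - 2 * q * T) / (sinh (q * T))\<^sup>2)
    + \<sigma>\<^sup>2 * exp (q * T) / (4 * q\<^sup>2) * ((sinh (2 * q * T) - 2 * q * T) / sinh (q * T))"
    using q X by (simp add: field_simps power2_eq_square)
  finally show ?thesis .
qed

text \<open>
  The integral representation and the space-time transform both have the bridge mean
  \<open>b sinh (q t) / sinh (q T)\<close> and the bridge variance; they differ only in the covariance
  \<open>\<sigma>\<^sup>2 c t\<close> with the process. Hence their distances differ in the time integral \<open>C\<close> of \<open>c\<close> alone. At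
  each time, the bridge is written as its mean plus \<open>\<sigma> y\<close> times a Wiener integral over an interval
  \<open>[0, r]\<close> that contains \<open>[0, t]\<close>.
\<close>

lemma distance_bridge:
  fixes V :: "real \<Rightarrow> 'a \<Rightarrow> real"
  assumes V: "\<And>t. 0 \<le> t \<Longrightarrow> t < T \<Longrightarrow> V t \<in> borel_measurable M"
    and cont: "\<And>\<omega>. \<omega> \<in> space M \<Longrightarrow> continuous_on {0..<T} (\<lambda>t. V t \<omega>)"
    and integral: "\<And>t. 0 < t \<Longrightarrow> t < T \<Longrightarrow> \<exists>f y r Y B C. t \<le> r \<and> has_wiener_integral M W f 0 r Y \<and>
      (\<forall>\<omega>\<in>space M. V t \<omega> = b * (sinh (q * t) / sinh (q * T)) + \<sigma> * y * Y \<omega>) \<and>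
      has_bochner_integral lborel (\<lambda>s. exp (q * (t - s)) * f s * indicator {0..t} s) B \<and> y * B = c t \<and>
      has_bochner_integral lborel (\<lambda>s. (f s)\<^sup>2 * indicator {0..r} s) C \<and>
      y\<^sup>2 * C = sinh (q * (T - t)) * sinh (q * t) / (q * sinh (q * T))"
    and c: "has_bochner_integral lborel (\<lambda>t. c t * indicator {0<..<T} t) C"
  shows "expectation (\<lambda>\<omega>. LBINT t=0..T. (U t \<omega> - V t \<omega>)\<^sup>2) =
    b\<^sup>2 / (4 * q) * ((sinh (2 * q * T) - 2 * q * T) / (sinh (q * T))\<^sup>2)
    + \<sigma>\<^sup>2 * ((exp (2 * q * T) - 1) / (4 * q\<^sup>2) - T / (2 * q)
      + (T * cosh (q * T) / (2 * q * sinh (q * T)) - 1 / (2 * q\<^sup>2)) - 2 * C)"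
proof -
  let ?m = "\<lambda>t. sinh (q * t) / sinh (q * T)"
  let ?v = "\<lambda>t. sinh (q * (T - t)) * sinh (q * t) / (q * sinh (q * T))"
  let ?h = "\<lambda>t. b\<^sup>2 * (?m t)\<^sup>2 + (\<sigma>\<^sup>2 * ((exp (2 * q * t) - 1) / (2 * q)) + (\<sigma>\<^sup>2 * ?v t + (- 2 * \<sigma>\<^sup>2) * c t))"
  have "has_bochner_integral lborel (\<lambda>t. ?h t * indicator {0<..<T} t)
      (b\<^sup>2 * (1 / (4 * q) * ((sinh (2 * q * T) - 2 * q * T) / (sinh (q * T))\<^sup>2))
      + (\<sigma>\<^sup>2 * ((exp (2 * q * T) - 1) / (4 * q\<^sup>2) - T / (2 * q))
      + (\<sigma>\<^sup>2 * (T * cosh (q * T) / (2 * q * sinh (q * T)) - 1 / (2 * q\<^sup>2)) + (- 2 * \<sigma>\<^sup>2) * C)))"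
    by (intro has_bochner_integral_Ioo_add has_bochner_integral_Ioo_cmult time_integral_mean_sq
        time_integral_OU_variance time_integral_bridge_variance c q T)
  then have "expectation (\<lambda>\<omega>. LBINT t=0..T. (U t \<omega> - V t \<omega>)\<^sup>2) =
      (b\<^sup>2 * (1 / (4 * q) * ((sinh (2 * q * T) - 2 * q * T) / (sinh (q * T))\<^sup>2))
      + (\<sigma>\<^sup>2 * ((exp (2 * q * T) - 1) / (4 * q\<^sup>2) - T / (2 * q))
      + (\<sigma>\<^sup>2 * (T * cosh (q * T) / (2 * q * sinh (q * T)) - 1 / (2 * q\<^sup>2)) + (- 2 * \<sigma>\<^sup>2) * C)))"
  proof (rule expectation_time_integral[OF T, rotated -1])
    fix t assume t: "0 < t" "t < T"
    from integral[OF t] obtain f y r Y B C where Y: "t \<le> r" "has_wiener_integral M W f 0 r Y"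
      and V_eq: "\<And>\<omega>. \<omega> \<in> space M \<Longrightarrow> V t \<omega> = b * ?m t + \<sigma> * y * Y \<omega>"
      and B: "has_bochner_integral lborel (\<lambda>s. exp (q * (t - s)) * f s * indicator {0..t} s) B" "y * B = c t"
      and C: "has_bochner_integral lborel (\<lambda>s. (f s)\<^sup>2 * indicator {0..r} s) C" "y\<^sup>2 * C = ?v t"
      by blast
    obtain I where I: "has_wiener_integral M W (\<lambda>s. exp (q * (t - s))) 0 t I"
      and UI: "\<And>\<omega>. \<omega> \<in> space M \<Longrightarrow> U t \<omega> = \<sigma> * I \<omega>"
      by (rule OU_process_integral[OF U less_imp_le[OF t(1)]]) blast
    have "has_bochner_integral M (\<lambda>\<omega>. (\<sigma> * I \<omega> + (- \<sigma> * y) * Y \<omega> + (- b * ?m t))\<^sup>2)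
        (\<sigma>\<^sup>2 * ((exp (2 * q * t) - 1) / (2 * q)) + 2 * \<sigma> * (- \<sigma> * y) * B + (- \<sigma> * y)\<^sup>2 * C + (- b * ?m t)\<^sup>2)"
      using integral_exp_sq[OF q, of t] t
      by (intro wiener_integrals_second_moment[OF I Y(2)] B C Y) simp
    also have "\<sigma>\<^sup>2 * ((exp (2 * q * t) - 1) / (2 * q)) + 2 * \<sigma> * (- \<sigma> * y) * B + (- \<sigma> * y)\<^sup>2 * C + (- b * ?m t)\<^sup>2 =
        b\<^sup>2 * (?m t)\<^sup>2 + (\<sigma>\<^sup>2 * ((exp (2 * q * t) - 1) / (2 * q)) + (\<sigma>\<^sup>2 * (y\<^sup>2 * C) + (- 2 * \<sigma>\<^sup>2) * (y * B)))"
      by (simp add: power2_eq_square)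
    also have "\<dots> = ?h t" unfolding B C ..
    finally have "has_bochner_integral M (\<lambda>\<omega>. (\<sigma> * I \<omega> + (- \<sigma> * y) * Y \<omega> + (- b * ?m t))\<^sup>2) (?h t)" .
    moreover have "(U t \<omega> - V t \<omega>)\<^sup>2 = (\<sigma> * I \<omega> + (- \<sigma> * y) * Y \<omega> + (- b * ?m t))\<^sup>2"
      if "\<omega> \<in> space M" for \<omega>
      using UI[OF that] V_eq[OF that] by (simp add: algebra_simps)
    ultimately show "has_bochner_integral M (\<lambda>\<omega>. (U t \<omega> - V t \<omega>)\<^sup>2) (?h t)"
      by (subst has_bochner_integral_cong[OF refl _ refl]) auto
  next
    show "(\<lambda>\<omega>. U t \<omega> - V t \<omega>) \<in> borel_measurable M" if "0 \<le> t" "t < T" for t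
      using OU_process_measurable[OF U] V that by simp
    show "continuous_on {0..<T} (\<lambda>t. U t \<omega> - V t \<omega>)" if "\<omega> \<in> space M" for \<omega>
    proof (intro continuous_on_diff cont that)
      show "continuous_on {0..<T} (\<lambda>t. U t \<omega>)"
        using U that unfolding OU_process_def by (auto intro: continuous_on_subset)
    qed
  qed
  then show ?thesis by (simp add: algebra_simps)
qed

lemma distance_ir:
  assumes V: "OU_bridge_ir M W q \<sigma> b T V"
  shows "expectation (\<lambda>\<omega>. LBINT t=0..T. (U t \<omega> - V t \<omega>)\<^sup>2) =
    b\<^sup>2 / (4 * q) * ((sinh (2 * q * T) - 2 * q * T) / (sinh (q * T))\<^sup>2)
    + \<sigma>\<^sup>2 * ((exp (2 * q * T) - 1) / (4 * q\<^sup>2) - T / (2 * q)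
      + (T * cosh (q * T) / (2 * q * sinh (q * T)) - 1 / (2 * q\<^sup>2))
      - 2 * (T\<^sup>2 / 4 - T / (4 * q) + (1 - exp (- 2 * q * T)) / (8 * q\<^sup>2)
        + 1 / (2 * q) * ((LBINT x=0..q * T. (1 - exp (- 2 * x)) * ln (sinh (q * T) / sinh x)) / q)))"
proof (rule distance_bridge)
  define k where "k t s = sinh (q * (T - t)) / sinh (q * (T - s))" for t s
  have int: "\<exists>I. has_wiener_integral M W (k t) 0 t I \<and>
      (\<forall>\<omega>\<in>space M. V t \<omega> = b * (sinh (q * t) / sinh (q * T)) + \<sigma> * I \<omega>)" if "0 \<le> t" "t < T" for t
    using V that unfolding OU_bridge_ir_def k_def by blast
  show "V t \<in> borel_measurable M" if "0 \<le> t" "t < T" for t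
  proof -
    from int[OF that] obtain I where I: "has_wiener_integral M W (k t) 0 t I"
      "\<And>\<omega>. \<omega> \<in> space M \<Longrightarrow> V t \<omega> = b * (sinh (q * t) / sinh (q * T)) + \<sigma> * I \<omega>" by blast
    note [measurable] = has_wiener_integral_measurable[OF I(1)]
    show ?thesis
      using I(2) by (subst measurable_cong[where g="\<lambda>\<omega>. b * (sinh (q * t) / sinh (q * T)) + \<sigma> * I \<omega>"]) auto
  qed
  show "continuous_on {0..<T} (\<lambda>t. V t \<omega>)" if "\<omega> \<in> space M" for \<omega>
    using V that unfolding OU_bridge_ir_def by blast
  let ?c = "\<lambda>t. (1 - exp (- 2 * (q * (T - t)))) / 2 * t
    + 1 / (2 * q) * ((1 - exp (- 2 * (q * (T - t)))) * ln (sinh (q * T) / sinh (q * (T - t))))"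
  show "has_bochner_integral lborel (\<lambda>t. ?c t * indicator {0<..<T} t)
      (T\<^sup>2 / 4 - T / (4 * q) + (1 - exp (- 2 * q * T)) / (8 * q\<^sup>2)
        + 1 / (2 * q) * ((LBINT x=0..q * T. (1 - exp (- 2 * x)) * ln (sinh (q * T) / sinh x)) / q))"
    by (intro has_bochner_integral_Ioo_add has_bochner_integral_Ioo_cmult time_integral_exp_linear
        time_integral_log q T)
  fix t assume t: "0 < t" "t < T"
  then obtain I where I: "has_wiener_integral M W (k t) 0 t I"
    "\<And>\<omega>. \<omega> \<in> space M \<Longrightarrow> V t \<omega> = b * (sinh (q * t) / sinh (q * T)) + \<sigma> * I \<omega>"
    using int[of t] by auto
  have B: "has_bochner_integral lborel (\<lambda>s. exp (q * (t - s)) * k t s * indicator {0..t} s)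
      ((1 - exp (- 2 * (q * (T - t)))) / 2 * (t + ln (sinh (q * T) / sinh (q * (T - t))) / q))"
    unfolding k_def using t q by (intro integral_exp_sinh_kernel) auto
  have C: "has_bochner_integral lborel (\<lambda>s. (k t s)\<^sup>2 * indicator {0..t} s)
      (sinh (q * (T - t)) * sinh (q * t) / (q * sinh (q * T)))"
    unfolding k_def using t q by (intro integral_sinh_kernel_sq) auto
  show "\<exists>f y r Y B C. t \<le> r \<and> has_wiener_integral M W f 0 r Y \<and>
      (\<forall>\<omega>\<in>space M. V t \<omega> = b * (sinh (q * t) / sinh (q * T)) + \<sigma> * y * Y \<omega>) \<and>
      has_bochner_integral lborel (\<lambda>s. exp (q * (t - s)) * f s * indicator {0..t} s) B \<and> y * B = ?c t \<and>
      has_bochner_integral lborel (\<lambda>s. (f s)\<^sup>2 * indicator {0..r} s) C \<and>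
      y\<^sup>2 * C = sinh (q * (T - t)) * sinh (q * t) / (q * sinh (q * T))"
  proof (intro exI conjI)
    show "has_wiener_integral M W (k t) 0 t I" by (rule I)
    show "\<forall>\<omega>\<in>space M. V t \<omega> = b * (sinh (q * t) / sinh (q * T)) + \<sigma> * 1 * I \<omega>"
      using I(2) by simp
    show "1 * ((1 - exp (- 2 * (q * (T - t)))) / 2 * (t + ln (sinh (q * T) / sinh (q * (T - t))) / q)) = ?c t"
      by (simp add: distrib_left)
  qed (use B C in simp_all)
qed

lemma distance_st:
  "expectation (\<lambda>\<omega>. LBINT t=0..T. (U t \<omega> - OU_bridge_st W q \<sigma> b T t \<omega>)\<^sup>2) =
    b\<^sup>2 / (4 * q) * ((sinh (2 * q * T) - 2 * q * T) / (sinh (q * T))\<^sup>2)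
    + \<sigma>\<^sup>2 * ((exp (2 * q * T) - 1) / (4 * q\<^sup>2) - T / (2 * q)
      + (T * cosh (q * T) / (2 * q * sinh (q * T)) - 1 / (2 * q\<^sup>2))
      - 2 * (T * exp (q * T) / (2 * q * sinh (q * T)) - 1 / (2 * q\<^sup>2) - (cosh (q * T) - 1) / (q\<^sup>2 * sinh (q * T))))"
proof (rule distance_bridge)
  define r where "r t = sinh (q * t) * sinh (q * T) / (q * sinh (q * (T - t)))" for t
  define y where "y t = sinh (q * (T - t)) / sinh (q * T)" for t
  have X: "sinh (q * T) \<noteq> 0" using q T by simp
  have V: "OU_bridge_st W q \<sigma> b T t = (\<lambda>\<omega>. b * (sinh (q * t) / sinh (q * T)) + \<sigma> * y t * W (r t) \<omega>)"
    if "0 \<le> t" "t < T" for t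
  proof -
    have "\<sigma> * exp (q * t) * ((OU_kappa q T - OU_kappa q t) / OU_kappa q T) = \<sigma> * y t"
      unfolding y_def space_time_factor[OF q that, symmetric] by (rule mult.assoc)
    moreover have "OU_kappa q t * OU_kappa q T / (OU_kappa q T - OU_kappa q t) = r t"
      unfolding r_def by (rule space_time_clock[OF q that])
    ultimately show ?thesis
      unfolding OU_bridge_st_def[abs_def] using that by (simp only: if_True)
  qed
  have r: "t \<le> r t" if "0 \<le> t" "t < T" for t
    using time_le_space_time_clock[OF q that] by (simp add: r_def)
  show "OU_bridge_st W q \<sigma> b T t \<in> borel_measurable M" if "0 \<le> t" "t < T" for t
    using measurable_W[of "r t"] r[OF that] that by (simp add: V[OF that])
  show "continuous_on {0..<T} (\<lambda>t. OU_bridge_st W q \<sigma> b T t \<omega>)" if "\<omega> \<in> space M" for \<omega>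
  proof -
    have "continuous_on {0..<T} (\<lambda>t. W (r t) \<omega>)"
    proof (rule continuous_on_compose2[OF continuous_paths[OF that]])
      show "continuous_on {0..<T} r"
        unfolding r_def using q by (intro continuous_intros) auto
      show "r ` {0..<T} \<subseteq> {0..}" using r by force
    qed
    then have "continuous_on {0..<T} (\<lambda>t. b * (sinh (q * t) / sinh (q * T)) + \<sigma> * y t * W (r t) \<omega>)"
      unfolding y_def using X by (intro continuous_intros) auto
    then show ?thesis using V by (subst continuous_on_cong[OF refl]) auto
  qed
  let ?c = "\<lambda>t. sinh (q * (T - t)) / sinh (q * T) * ((exp (q * t) - 1) / q)"
  show "has_bochner_integral lborel (\<lambda>t. ?c t * indicator {0<..<T} t)
      (T * exp (q * T) / (2 * q * sinh (q * T)) - 1 / (2 * q\<^sup>2) - (cosh (q * T) - 1) / (q\<^sup>2 * sinh (q * T)))"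
    by (rule time_integral_st_covariance[OF q T])
  fix t assume t: "0 < t" "t < T"
  have r0: "0 \<le> r t" using r[of t] t by simp
  have C: "(y t)\<^sup>2 * r t = sinh (q * (T - t)) * sinh (q * t) / (q * sinh (q * T))"
    using t q X by (simp add: y_def r_def power2_eq_square)
  show "\<exists>f y r Y B C. t \<le> r \<and> has_wiener_integral M W f 0 r Y \<and>
      (\<forall>\<omega>\<in>space M. OU_bridge_st W q \<sigma> b T t \<omega> = b * (sinh (q * t) / sinh (q * T)) + \<sigma> * y * Y \<omega>) \<and>
      has_bochner_integral lborel (\<lambda>s. exp (q * (t - s)) * f s * indicator {0..t} s) B \<and> y * B = ?c t \<and>
      has_bochner_integral lborel (\<lambda>s. (f s)\<^sup>2 * indicator {0..r} s) C \<and>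
      y\<^sup>2 * C = sinh (q * (T - t)) * sinh (q * t) / (q * sinh (q * T))"
  proof (intro exI conjI)
    show "has_wiener_integral M W (\<lambda>_. 1) 0 (r t) (W (r t))"
      using r0 by (rule has_wiener_integral_one)
    show "\<forall>\<omega>\<in>space M. OU_bridge_st W q \<sigma> b T t \<omega> =
        b * (sinh (q * t) / sinh (q * T)) + \<sigma> * y t * W (r t) \<omega>"
      using V[of t] t by simp
    show "has_bochner_integral lborel (\<lambda>s. exp (q * (t - s)) * 1 * indicator {0..t} s) ((exp (q * t) - 1) / q)"
      using integral_exp[OF q, of t] t by simp
    show "has_bochner_integral lborel (\<lambda>s. 1\<^sup>2 * indicator {0..r t} s) (r t)"
      using has_bochner_integral_real_indicator[of "{0..r t}" lborel] r0 by simp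
  qed (use t r[of t] C in \<open>simp_all add: y_def\<close>)
qed

end

end

theorem theorem3p7:
  fixes M :: "'a measure" and W U\<^sub>0 U\<^sub>i\<^sub>r :: "real \<Rightarrow> 'a \<Rightarrow> real" and T q \<sigma> b :: real
  assumes "T > 0" and "q \<noteq> 0" and "\<sigma> > 0"
    and "wiener_process M W"
    and "OU_process M W q \<sigma> U\<^sub>0"
    and "OU_bridge_ir M W q \<sigma> b T U\<^sub>i\<^sub>r"
  shows
    "prob_space.expectation M (\<lambda>\<omega>. LBINT t=0..T. (U\<^sub>0 t \<omega> - OU_bridge_av q b T U\<^sub>0 t \<omega>)\<^sup>2) =
       b\<^sup>2 / (4 * q) * ((sinh (2 * q * T) - 2 * q * T) / (sinh (q * T))\<^sup>2)
       + \<sigma>\<^sup>2 * exp (q * T) / (4 * q\<^sup>2) * ((sinh (2 * q * T) - 2 * q * T) / sinh (q * T))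
     \<and>
     prob_space.expectation M (\<lambda>\<omega>. LBINT t=0..T. (U\<^sub>0 t \<omega> - U\<^sub>i\<^sub>r t \<omega>)\<^sup>2) =
       b\<^sup>2 / (4 * q) * ((sinh (2 * q * T) - 2 * q * T) / (sinh (q * T))\<^sup>2)
       + \<sigma>\<^sup>2 * exp (q * T) / (4 * q\<^sup>2) * ((sinh (2 * q * T) - 2 * q * T) / sinh (q * T))
       - \<sigma>\<^sup>2 / q\<^sup>2
       + T * \<sigma>\<^sup>2 * cosh (q * T) / (q * sinh (q * T))
       - \<sigma>\<^sup>2 * T\<^sup>2 / 2 + \<sigma>\<^sup>2 * T / (2 * q) - \<sigma>\<^sup>2 / (4 * q\<^sup>2)
       + \<sigma>\<^sup>2 / (4 * q\<^sup>2) * exp (- 2 * q * T)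
       - \<sigma>\<^sup>2 / q\<^sup>2 * (LBINT x=0..q * T. (1 - exp (- 2 * x)) * ln (sinh (q * T) / sinh x))
     \<and>
     prob_space.expectation M (\<lambda>\<omega>. LBINT t=0..T. (U\<^sub>0 t \<omega> - OU_bridge_st W q \<sigma> b T t \<omega>)\<^sup>2) =
       b\<^sup>2 / (4 * q) * ((sinh (2 * q * T) - 2 * q * T) / (sinh (q * T))\<^sup>2)
       + \<sigma>\<^sup>2 * exp (q * T) / (4 * q\<^sup>2) * ((sinh (2 * q * T) - 2 * q * T) / sinh (q * T))
       + 2 * \<sigma>\<^sup>2 / q\<^sup>2 * ((cosh (q * T) - 1) / sinh (q * T))
       - \<sigma>\<^sup>2 / q * (sinh (2 * q * T) / (2 * q) + T)
       + \<sigma>\<^sup>2 * cosh (q * T) / (2 * q\<^sup>2 * sinh (q * T)) * (cosh (2 * q * T) - 1)"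
proof (intro conjI)
  interpret wiener_process M W by fact
  define S where "S = sinh (q * T)"
  define C where "C = cosh (q * T)"
  define L where "L = (LBINT x=0..q * T. (1 - exp (- 2 * x)) * ln (sinh (q * T) / sinh x))"
  have S: "S \<noteq> 0" using assms(1,2) by (simp add: S_def)
  have pyth: "C\<^sup>2 = S\<^sup>2 + 1" unfolding C_def S_def by (rule cosh_square_eq)
  have expand: "sinh (2 * q * T) = 2 * S * C" "cosh (2 * q * T) = C\<^sup>2 + S\<^sup>2"
    "exp (q * T) = S + C" "exp (2 * q * T) = (S + C)\<^sup>2"
    unfolding S_def C_def using sinh_double[of "q * T"] cosh_double[of "q * T"]
    by (simp_all add: sinh_plus_cosh mult.assoc exp_double)
  note fold_SC = S_def[symmetric] C_def[symmetric] L_def[symmetric]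
  show "expectation (\<lambda>\<omega>. LBINT t=0..T. (U\<^sub>0 t \<omega> - OU_bridge_av q b T U\<^sub>0 t \<omega>)\<^sup>2) =
       b\<^sup>2 / (4 * q) * ((sinh (2 * q * T) - 2 * q * T) / (sinh (q * T))\<^sup>2)
       + \<sigma>\<^sup>2 * exp (q * T) / (4 * q\<^sup>2) * ((sinh (2 * q * T) - 2 * q * T) / sinh (q * T))"
    by (rule distance_av) fact+
  \<comment> \<open>the variances of process and bridge, integrated over time, give the summands that the
    distances of the last two versions have in common\<close>
  have reduce: "(exp (2 * q * T) - 1) / (4 * q\<^sup>2) - T / (2 * q) + (T * C / (2 * q * S) - 1 / (2 * q\<^sup>2)) =
      exp (q * T) / (4 * q\<^sup>2) * ((sinh (2 * q * T) - 2 * q * T) / S) - 1 / q\<^sup>2 + T * C / (q * S)"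
  proof -
    have CC: "C * (C * x) = x + S * (S * x)" for x
      using pyth by (simp add: power2_eq_square distrib_right flip: mult.assoc)
    show ?thesis
      unfolding expand using S assms(2) by (simp add: field_simps power2_eq_square CC)
  qed
  show "expectation (\<lambda>\<omega>. LBINT t=0..T. (U\<^sub>0 t \<omega> - U\<^sub>i\<^sub>r t \<omega>)\<^sup>2) =
       b\<^sup>2 / (4 * q) * ((sinh (2 * q * T) - 2 * q * T) / (sinh (q * T))\<^sup>2)
       + \<sigma>\<^sup>2 * exp (q * T) / (4 * q\<^sup>2) * ((sinh (2 * q * T) - 2 * q * T) / sinh (q * T))
       - \<sigma>\<^sup>2 / q\<^sup>2
       + T * \<sigma>\<^sup>2 * cosh (q * T) / (q * sinh (q * T))
       - \<sigma>\<^sup>2 * T\<^sup>2 / 2 + \<sigma>\<^sup>2 * T / (2 * q) - \<sigma>\<^sup>2 / (4 * q\<^sup>2)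
       + \<sigma>\<^sup>2 / (4 * q\<^sup>2) * exp (- 2 * q * T)
       - \<sigma>\<^sup>2 / q\<^sup>2 * (LBINT x=0..q * T. (1 - exp (- 2 * x)) * ln (sinh (q * T) / sinh x))"
    unfolding distance_ir[OF assms(2,1,5,6)] fold_SC reduce
    using S assms(2) by (simp add: algebra_simps diff_divide_distrib power2_eq_square)
  show "expectation (\<lambda>\<omega>. LBINT t=0..T. (U\<^sub>0 t \<omega> - OU_bridge_st W q \<sigma> b T t \<omega>)\<^sup>2) =
       b\<^sup>2 / (4 * q) * ((sinh (2 * q * T) - 2 * q * T) / (sinh (q * T))\<^sup>2)
       + \<sigma>\<^sup>2 * exp (q * T) / (4 * q\<^sup>2) * ((sinh (2 * q * T) - 2 * q * T) / sinh (q * T))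
       + 2 * \<sigma>\<^sup>2 / q\<^sup>2 * ((cosh (q * T) - 1) / sinh (q * T))
       - \<sigma>\<^sup>2 / q * (sinh (2 * q * T) / (2 * q) + T)
       + \<sigma>\<^sup>2 * cosh (q * T) / (2 * q\<^sup>2 * sinh (q * T)) * (cosh (2 * q * T) - 1)"
  proof -
    \<comment> \<open>the last summand of the claim cancels against \<open>\<sigma>\<^sup>2 / q * (sinh (2 * q * T) / (2 * q))\<close>\<close>
    have "C / S * (cosh (2 * q * T) - 1) = sinh (2 * q * T)"
      unfolding expand using pyth S by (simp add: field_simps power2_eq_square)
    then have cancel: "\<sigma>\<^sup>2 * C / (2 * q\<^sup>2 * S) * (cosh (2 * q * T) - 1) = \<sigma>\<^sup>2 / (2 * q\<^sup>2) * sinh (2 * q * T)"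
      by (metis (no_types, lifting) times_divide_times_eq mult.assoc)
    have last: "T * (S + C) / (2 * q * S) = T / (2 * q) + T * C / (2 * q * S)"
      using S by (simp add: distrib_left add_divide_distrib)
    show ?thesis
      unfolding distance_st[OF assms(2,1,5)] fold_SC reduce cancel
      unfolding expand(3) last
      using S assms(2) by (simp add: field_simps power2_eq_square)
  qed
qed

end
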